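(* Any isoparametric string of the second class is congruent to a symmetrical configuration of the second kind. That is, if $\gamma$ is (a natural parametrization of) an isoparametric string of the second class, there exist $A\in G$, $r\in(-2,-1/2)\cap\mathbb Q$ and $\rho\in(0,\sqrt2)$ such that $A\gamma$ is the symmetrical configuration $\eta_{r,\rho}$ of the second kind, up to a shift of the natural parameter.
   Context: $\mathbb C^{2,1}$ is $\mathbb C^3$ with the Hermitian form $\langle \mathbf z,\mathbf w\rangle={}^t\overline{\mathbf z}\,\mathbf h\,\mathbf w$, $\mathbf h=\begin{pmatrix}0&0&i\\0&1&0\\-i&0&0\end{pmatrix}$. $\mathcal N$ is the set of nonzero null vectors, $\mathcal S=\{[\mathbf z]\in\mathbb{CP}^2:\langle\mathbf z,\mathbf z\rangle=0\}$. $G=\{A\in SL(3,\mathbb C):{}^t\bar A\mathbf hA=\mathbf h\}$ acts on $\mathcal S$ by $A[\mathbf z]=[A\mathbf z]$; curves are congruent if related by an element of $G$. Curves. A lift of a smooth curve $\gamma:\mathbb R\to\mathcal S$ is a smooth $\Gamma:\mathbb R\to\mathcal N$ with $\gamma=[\Gamma]$. $\gamma$ is (positively parametrized) transversal if $-i\langle\Gamma,\Gamma'\rangle>0$, and generic if $\det(\Gamma,\Gamma',\Gamma'')$ never vanishes. A Wilczynski lift has $\det(\Gamma,\Gamma',\Gamma'')=-1$; the parametrization is natural if moreover $i\langle\Gamma,\Gamma'\rangle^{-1}=1$, and then bending and twist are $\kappa=\frac12\langle\Gamma',\Gamma'\rangle$, $\tau=\mathrm{Im}\langle\Gamma'',\Gamma'\rangle+3\kappa^2$.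 A generic transversal curve is isoparametric if $\kappa,\tau$ are constant; an isoparametric string is a closed (periodic) isoparametric curve. For isoparametric strings the discriminant $D_{\kappa,\tau}=-27+108\kappa(\kappa^2+\tau)-324\kappa^4\tau-72\kappa^2\tau^2-4\tau^3$ of the characteristic polynomial of $\mathrm H_{\kappa,\tau}=i\begin{pmatrix}i\kappa&-i&\tau\\0&-2i\kappa&1\\1&0&i\kappa\end{pmatrix}$ is positive, and the spectral ratio $e_1/e_3$ of its eigenvalues $e_1<e_2<e_3$ lies in $(-2,-1/2)\cap\mathbb Q$. The string is of the first class if $3\kappa>|\tau|^{1/2}$, of the second class if $3\kappa<|\tau|^{1/2}$. Symmetrical configurations of the second kind. For $(r,\rho)\in(-2,-\frac12)\times(0,\sqrt2)$ let $$\mu_2(r,\rho)=\frac{-4+4r-12\rho^2(1+r)+(r-1)\rho^4}{-4+4r-12\rho^2(1+r)+(r-1)\rho^4-2\big((2+3r-3r^2-2r^3)(-4\rho+\rho^5)\big)^{2/3}}\in(0,1),$$ $e_2^1=r\frac{\mu_2}{1-\mu_2}$, $e_2^2=-(1+r)\frac{\mu_2}{1-\mu_2}$, $e_2^3=\frac{\mu_2}{1-\mu_2}$, $D_2(r,\rho)=\mathrm{diag}(-ie_2^3,-ie_2^2,-ie_2^1)$, $\mathcal U=\begin{pmatrix}\frac1{\sqrt2}&0&\frac i{\sqrt2}\\0&1&0\\\frac i{\sqrt2}&0&\frac1{\sqrt2}\end{pmatrix}$, $S(\rho)=[{}^t(1,\rho,i\rho^2/2)]\in\mathcal S$. For $r\in\mathbb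 Q$, the symmetrical configuration of the second kind with parameters $(r,\rho)$ is $\eta_{r,\rho}(s)=\big(\mathcal U\exp(sD_2(r,\rho))\,\mathcal U^{-1}\big)S(\rho)$. *)

theory Defs
  imports "HOL-Analysis.Analysis"
begin

section \<open>The Hermitian space and its group\<close>

definition herm_matrix :: "complex^3^3" where
  "herm_matrix = vector [vector [0, 0, \<i>], vector [0, 1, 0], vector [-\<i>, 0, 0]]"

definition conj_vec :: "complex^3 \<Rightarrow> complex^3" where
  "conj_vec z = (\<chi> j. cnj (z $ j))"

definition conj_transpose :: "complex^3^3 \<Rightarrow> complex^3^3" where
  "conj_transpose A = (\<chi> j k. cnj (A $ k $ j))"

text \<open>Conjugate-linear in the first argument. The library's inner product on
  \<^typ>\<open>complex^3\<close> is a real positive definite one, so it cannot be used here.\<close>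
definition herm :: "complex^3 \<Rightarrow> complex^3 \<Rightarrow> complex" where
  "herm z w = (\<Sum>j\<in>UNIV. conj_vec z $ j * (herm_matrix *v w) $ j)"

definition null_vectors :: "(complex^3) set" where
  "null_vectors = {z. z \<noteq> 0 \<and> herm z z = 0}"

definition SU21 :: "(complex^3^3) set" where
  "SU21 = {A. det A = 1 \<and> conj_transpose A ** herm_matrix ** A = herm_matrix}"

section \<open>The projective plane\<close>

text \<open>A point of the complex projective plane is a complex line through the origin;
  \<^term>\<open>vec.span\<close> is the span over the complex numbers. Matrices act on lines by taking images.\<close>
type_synonym cline = "(complex^3) set"

definition proj :: "complex^3 \<Rightarrow> cline" where
  "proj z = vec.span {z}"

definition act :: "complex^3^3 \<Rightarrow> cline \<Rightarrow> cline" where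
  "act A p = (\<lambda>z. A *v z) ` p"

definition quadric :: "cline set" where
  "quadric = proj ` null_vectors"

section \<open>Curves and their lifts\<close>

definition vderiv :: "(real \<Rightarrow> complex^3) \<Rightarrow> real \<Rightarrow> complex^3" where
  "vderiv \<Gamma> t = vector_derivative \<Gamma> (at t)"

definition smooth :: "(real \<Rightarrow> complex^3) \<Rightarrow> bool" where
  "smooth \<Gamma> \<longleftrightarrow> (\<forall>n t. (vderiv ^^ n) \<Gamma> differentiable (at t))"

definition is_lift :: "(real \<Rightarrow> complex^3) \<Rightarrow> (real \<Rightarrow> cline) \<Rightarrow> bool" where
  "is_lift \<Gamma> \<gamma> \<longleftrightarrow>
     (\<forall>t. \<gamma> t \<in> quadric) \<and> smooth \<Gamma> \<and> (\<forall>t. \<Gamma> t \<in> null_vectors \<and> \<gamma> t = proj (\<Gamma> t))"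

definition det_lift :: "(real \<Rightarrow> complex^3) \<Rightarrow> real \<Rightarrow> complex" where
  "det_lift \<Gamma> t = det (transpose (vector [\<Gamma> t, vderiv \<Gamma> t, vderiv (vderiv \<Gamma>) t] :: complex^3^3))"

text \<open>Smoothness of a curve in the projective plane is encoded as existence of a smooth lift
  (every smooth curve defined on all of \<open>\<real>\<close> has one). Transversality and
  genericity do not depend on the chosen lift: replacing \<open>\<Gamma>\<close> by \<open>f \<Gamma>\<close> multiplies
  \<open>\<langle>\<Gamma>, \<Gamma>'\<rangle>\<close> by \<open>\<bar>f\<bar>\<^sup>2\<close> and the determinant by \<open>f ^ 3\<close>. Since \<open>\<Gamma>\<close> is null,
  \<open>-\<i> \<langle>\<Gamma>, \<Gamma>'\<rangle>\<close> is real.\<close>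
definition transversal :: "(real \<Rightarrow> cline) \<Rightarrow> bool" where
  "transversal \<gamma> \<longleftrightarrow> (\<exists>\<Gamma>. is_lift \<Gamma> \<gamma> \<and> (\<forall>t. Re (- \<i> * herm (\<Gamma> t) (vderiv \<Gamma> t)) > 0))"

definition generic :: "(real \<Rightarrow> cline) \<Rightarrow> bool" where
  "generic \<gamma> \<longleftrightarrow> (\<exists>\<Gamma>. is_lift \<Gamma> \<gamma> \<and> (\<forall>t. det_lift \<Gamma> t \<noteq> 0))"

definition wilczynski_lift :: "(real \<Rightarrow> complex^3) \<Rightarrow> (real \<Rightarrow> cline) \<Rightarrow> bool" where
  "wilczynski_lift \<Gamma> \<gamma> \<longleftrightarrow> is_lift \<Gamma> \<gamma> \<and> (\<forall>t. det_lift \<Gamma> t = -1)"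

definition natural_lift :: "(real \<Rightarrow> complex^3) \<Rightarrow> (real \<Rightarrow> cline) \<Rightarrow> bool" where
  "natural_lift \<Gamma> \<gamma> \<longleftrightarrow>
     wilczynski_lift \<Gamma> \<gamma> \<and> (\<forall>t. \<i> * inverse (herm (\<Gamma> t) (vderiv \<Gamma> t)) = 1)"

definition bending :: "(real \<Rightarrow> complex^3) \<Rightarrow> real \<Rightarrow> real" where
  "bending \<Gamma> t = 1/2 * Re (herm (vderiv \<Gamma> t) (vderiv \<Gamma> t))"

definition twist :: "(real \<Rightarrow> complex^3) \<Rightarrow> real \<Rightarrow> real" where
  "twist \<Gamma> t = Im (herm (vderiv (vderiv \<Gamma>) t) (vderiv \<Gamma> t)) + 3 * (bending \<Gamma> t)\<^sup>2"

text \<open>A naturally parametrized isoparametric curve with bending \<open>\<kappa>\<close> and twist \<open>\<tau>\<close>. Two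
  Wilczynski lifts of the same curve differ by a constant cube root of unity, so bending and
  twist do not depend on the lift.\<close>
definition isoparametric :: "(real \<Rightarrow> cline) \<Rightarrow> real \<Rightarrow> real \<Rightarrow> bool" where
  "isoparametric \<gamma> \<kappa> \<tau> \<longleftrightarrow> generic \<gamma> \<and> transversal \<gamma> \<and>
     (\<exists>\<Gamma>. natural_lift \<Gamma> \<gamma> \<and> (\<forall>t. bending \<Gamma> t = \<kappa> \<and> twist \<Gamma> t = \<tau>))"

definition isoparametric_string :: "(real \<Rightarrow> cline) \<Rightarrow> real \<Rightarrow> real \<Rightarrow> bool" where
  "isoparametric_string \<gamma> \<kappa> \<tau> \<longleftrightarrow>
     isoparametric \<gamma> \<kappa> \<tau> \<and> (\<exists>\<omega>>0. \<forall>t. \<gamma> (t + \<omega>) = \<gamma> t)"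

definition second_class :: "real \<Rightarrow> real \<Rightarrow> bool" where
  "second_class \<kappa> \<tau> \<longleftrightarrow> 3 * \<kappa> < sqrt \<bar>\<tau>\<bar>"

section \<open>Symmetrical configurations of the second kind\<close>

text \<open>On \<open>(-2, -1/2) \<times> (0, \<surd>2)\<close> the base of the fractional power is positive, so
  \<^const>\<open>powr\<close> is the intended power.\<close>
definition \<mu>\<^sub>2 :: "real \<Rightarrow> real \<Rightarrow> real" where
  "\<mu>\<^sub>2 r \<rho> =
     (-4 + 4*r - 12*\<rho>^2*(1 + r) + (r - 1)*\<rho>^4) /
     (-4 + 4*r - 12*\<rho>^2*(1 + r) + (r - 1)*\<rho>^4
        - 2 * ((2 + 3*r - 3*r^2 - 2*r^3) * (-4*\<rho> + \<rho>^5)) powr (2/3))"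

definition e21 :: "real \<Rightarrow> real \<Rightarrow> real" where
  "e21 r \<rho> = r * (\<mu>\<^sub>2 r \<rho> / (1 - \<mu>\<^sub>2 r \<rho>))"

definition e22 :: "real \<Rightarrow> real \<Rightarrow> real" where
  "e22 r \<rho> = - (1 + r) * (\<mu>\<^sub>2 r \<rho> / (1 - \<mu>\<^sub>2 r \<rho>))"

definition e23 :: "real \<Rightarrow> real \<Rightarrow> real" where
  "e23 r \<rho> = \<mu>\<^sub>2 r \<rho> / (1 - \<mu>\<^sub>2 r \<rho>)"

definition D\<^sub>2 :: "real \<Rightarrow> real \<Rightarrow> complex^3^3" where
  "D\<^sub>2 r \<rho> = vector [vector [- \<i> * of_real (e23 r \<rho>), 0, 0],
                    vector [0, - \<i> * of_real (e22 r \<rho>), 0],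
                    vector [0, 0, - \<i> * of_real (e21 r \<rho>)]]"

text \<open>The power \<open>A ^ n\<close> on \<^typ>\<open>complex^3^3\<close> would be componentwise and
  \<^const>\<open>exp\<close> is not available there, so the series is written with \<open>**\<close>.\<close>
definition matrix_exp :: "complex^3^3 \<Rightarrow> complex^3^3" where
  "matrix_exp A = (\<Sum>n. (((**) A) ^^ n) (mat 1) /\<^sub>R fact n)"

definition U_matrix :: "complex^3^3" where
  "U_matrix = vector [vector [1 / of_real (sqrt 2), 0, \<i> / of_real (sqrt 2)],
                      vector [0, 1, 0],
                      vector [\<i> / of_real (sqrt 2), 0, 1 / of_real (sqrt 2)]]"

definition S_point :: "real \<Rightarrow> cline" where
  "S_point \<rho> = proj (vector [1, of_real \<rho>, \<i> * of_real (\<rho>^2) / 2])"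

definition sym_config2 :: "real \<Rightarrow> real \<Rightarrow> real \<Rightarrow> cline" where
  "sym_config2 r \<rho> s =
     act (U_matrix ** matrix_exp (s *\<^sub>R D\<^sub>2 r \<rho>) ** matrix_inv U_matrix) (S_point \<rho>)"

end

(* A natural lift with constant bending and twist satisfies a linear differential equation of order
   three with constant coefficients. Projective periodicity forces the characteristic roots
   x < y < z to be real and simple with rational ratios, so that the lift is a sum of three
   exponentials exp (i x t) v with pairwise orthogonal v. The norms of these vectors are Lagrange
   weights (x + 2 kappa) / ((x - y) (x - z)), and (x + 2 kappa) (y + 2 kappa) (z + 2 kappa) = 1.
   Being of the second class means y < -2 kappa < z, that is, the timelike vector belongs to the
   least root, as for the configurations of the second kind. The ratio of the weights determines
   rho, the ratio of the roots determines r, and the normalisation of the lift determines the scale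
   of the roots, which gives mu_2. Mapping the normalised eigenvectors to the columns of U is then
   the required congruence, without any shift of the parameter. *)
theory Submission
  imports Defs "HOL-Computational_Algebra.Fundamental_Theorem_Algebra"
begin

section \<open>The Hermitian form\<close>

lemma herm_expand:
  "herm z w = \<i> * cnj (z$1) * w$3 + cnj (z$2) * w$2 - \<i> * cnj (z$3) * w$1"
  by (simp add: herm_def conj_vec_def herm_matrix_def matrix_vector_mult_def sum_3 vector_3)

lemma herm_add_left: "herm (u + v) w = herm u w + herm v w"
  and herm_add_right: "herm u (v + w) = herm u v + herm u w"
  and herm_diff_left: "herm (u - v) w = herm u w - herm v w"
  and herm_diff_right: "herm u (v - w) = herm u v - herm u w"
  and herm_scale_left: "herm (c *s u) w = cnj c * herm u w"
  and herm_scale_right: "herm u (c *s w) = c * herm u w"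
  by (simp_all add: herm_expand algebra_simps)

lemmas herm_linear = herm_add_left herm_add_right herm_diff_left herm_diff_right
  herm_scale_left herm_scale_right

lemma herm_commute: "herm w z = cnj (herm z w)"
  by (simp add: herm_expand algebra_simps)

lemma has_vector_derivative_nth:
  assumes "(f has_vector_derivative f') F"
  shows "((\<lambda>t. f t $ i) has_vector_derivative f' $ i) F"
  using assms by (rule bounded_linear.has_vector_derivative[OF bounded_linear_vec_nth])

lemma has_vector_derivative_herm:
  assumes "(f has_vector_derivative f') (at t)" "(g has_vector_derivative g') (at t)"
  shows "((\<lambda>t. herm (f t) (g t)) has_vector_derivative herm f' (g t) + herm (f t) g') (at t)"
  unfolding herm_expand
  by (rule derivative_eq_intros has_vector_derivative_cnj has_vector_derivative_nth assms refl)+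
     (simp add: algebra_simps)

lemma vector_derivative_const_unique:
  assumes "(f has_vector_derivative f') (at t)" "\<And>t. f t = c"
  shows "f' = 0"
  using vector_derivative_unique_at[OF assms(1), of 0] assms(2)
  by (metis has_vector_derivative_const has_vector_derivative_transform UNIV_I)

section \<open>Determinants of three vectors and their Gram matrix\<close>

definition det3 :: "complex^3 \<Rightarrow> complex^3 \<Rightarrow> complex^3 \<Rightarrow> complex" where
  "det3 u v w = det (transpose (vector [u, v, w] :: complex^3^3))"

lemma det3_expand:
  "det3 u v w = u$1 * (v$2 * w$3 - v$3 * w$2) - u$2 * (v$1 * w$3 - v$3 * w$1)
     + u$3 * (v$1 * w$2 - v$2 * w$1)"
  by (simp add: det3_def transpose_def det_3 vector_3 algebra_simps)

lemma det3_degenerate: "det3 u u w = 0" "det3 u v v = 0"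
  by (simp_all add: det3_expand algebra_simps)

lemma has_vector_derivative_det3:
  assumes "(f has_vector_derivative f') (at t)" "(g has_vector_derivative g') (at t)"
    "(h has_vector_derivative h') (at t)"
  shows "((\<lambda>t. det3 (f t) (g t) (h t)) has_vector_derivative
     det3 f' (g t) (h t) + det3 (f t) g' (h t) + det3 (f t) (g t) h') (at t)"
  unfolding det3_expand
  by (rule derivative_eq_intros has_vector_derivative_nth assms refl)+
     (simp add: algebra_simps)

text \<open>Cramer's rule free of denominators; for a frame of determinant -1 it gives coordinates
  directly.\<close>

lemma det3_cramer:
  "det3 u v w *s x = det3 x v w *s u + det3 u x w *s v + det3 u v x *s w"
  by (simp add: vec_eq_iff forall_3 det3_expand algebra_simps)

text \<open>The Gram determinant is the squared modulus of the determinant times det h = -1, hence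
  the sign.\<close>

lemma det3_gram:
  "cnj (det3 u v w) * det3 u v w =
     - (herm u u * (herm v v * herm w w - herm v w * herm w v)
      - herm u v * (herm v u * herm w w - herm v w * herm w u)
      + herm u w * (herm v u * herm w v - herm v v * herm w u))"
proof -
  have *: "\<i> * (\<i> * x) = - x" for x :: complex by (simp flip: mult.assoc)
  show ?thesis by (simp add: herm_expand det3_expand algebra_simps *)
qed

lemma cnj_mult_self_eq_1_iff: "cnj c * c = 1 \<longleftrightarrow> norm c = 1"
proof -
  have "cnj c * c = of_real ((norm c)\<^sup>2)"
    by (simp add: complex_norm_square mult.commute del: of_real_power)
  then have "cnj c * c = 1 \<longleftrightarrow> (norm c)\<^sup>2 = 1"
    by (simp only: of_real_eq_1_iff)
  also have "\<dots> \<longleftrightarrow> norm c = 1"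
    by (auto simp: power2_eq_1_iff) (use norm_ge_zero[of c] in linarith)
  finally show ?thesis .
qed

section \<open>The frame of a natural lift\<close>

text \<open>Here \<open>b = \<tau> - 3\<kappa>\<^sup>2\<close> is \<open>Im \<langle>\<Gamma>'', \<Gamma>'\<rangle>\<close>. The value of
  \<open>\<langle>\<Gamma>'', \<Gamma>''\<rangle>\<close> is forced by the Gram determinant, whose value is
  \<open>\<bar>det\<bar>\<^sup>2 det h = -1\<close>.\<close>
definition frame :: "real \<Rightarrow> real \<Rightarrow> (real \<Rightarrow> complex^3) \<Rightarrow> (real \<Rightarrow> complex^3) \<Rightarrow> (real \<Rightarrow> complex^3) \<Rightarrow> bool"
  where
  "frame \<kappa> b g0 g1 g2 \<longleftrightarrow> (\<forall>t.
     (g0 has_vector_derivative g1 t) (at t) \<and> (g1 has_vector_derivative g2 t) (at t) \<and>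
     (g2 has_vector_derivative
        of_real b *s g1 t - (\<i> * of_real (1 - 2 * \<kappa> * b - 8 * \<kappa>^3)) *s g0 t) (at t) \<and>
     herm (g0 t) (g0 t) = 0 \<and> herm (g0 t) (g1 t) = \<i> \<and> herm (g1 t) (g0 t) = - \<i> \<and>
     herm (g0 t) (g2 t) = of_real (- 2 * \<kappa>) \<and> herm (g2 t) (g0 t) = of_real (- 2 * \<kappa>) \<and>
     herm (g1 t) (g1 t) = of_real (2 * \<kappa>) \<and>
     herm (g1 t) (g2 t) = - \<i> * of_real b \<and> herm (g2 t) (g1 t) = \<i> * of_real b \<and>
     herm (g2 t) (g2 t) = of_real (1 - 4 * \<kappa> * b - 8 * \<kappa>^3) \<and>
     det3 (g0 t) (g1 t) (g2 t) = -1)"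

lemma smooth_has_vector_derivative:
  assumes "smooth \<Gamma>"
  shows "((vderiv ^^ n) \<Gamma> has_vector_derivative (vderiv ^^ Suc n) \<Gamma> t) (at t)"
  using assms by (simp add: smooth_def vderiv_def vector_derivative_works flip: vderiv_def)

text \<open>Each Hermitian product of derivatives is constant, and differentiating it determines one
  of higher order. The third derivative is then recovered from its products with the lift and its
  first derivative.\<close>

lemma natural_lift_frame:
  assumes "natural_lift \<Gamma> \<gamma>" and "\<And>t. bending \<Gamma> t = \<kappa> \<and> twist \<Gamma> t = \<tau>"
  shows "frame \<kappa> (\<tau> - 3 * \<kappa>\<^sup>2) \<Gamma> (vderiv \<Gamma>) (vderiv (vderiv \<Gamma>))"
proof -
  define b where "b = \<tau> - 3 * \<kappa>\<^sup>2"
  define g1 where "g1 = vderiv \<Gamma>"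
  define g2 where "g2 = vderiv g1"
  define g3 where "g3 = vderiv g2"
  have lift: "is_lift \<Gamma> \<gamma>" and det: "\<And>t. det3 (\<Gamma> t) (g1 t) (g2 t) = -1"
    and nat: "\<And>t. \<i> * inverse (herm (\<Gamma> t) (g1 t)) = 1"
    using assms(1) by (auto simp: natural_lift_def wilczynski_lift_def det_lift_def det3_def g1_def g2_def)
  have sm: "smooth \<Gamma>" using lift by (simp add: is_lift_def)
  have d0: "(\<Gamma> has_vector_derivative g1 t) (at t)"
    and d1: "(g1 has_vector_derivative g2 t) (at t)"
    and d2: "(g2 has_vector_derivative g3 t) (at t)" for t
    using smooth_has_vector_derivative[OF sm, of 0 t] smooth_has_vector_derivative[OF sm, of 1 t]
      smooth_has_vector_derivative[OF sm, of 2 t]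
    by (simp_all add: g1_def g2_def g3_def numeral_2_eq_2)
  have h00: "herm (\<Gamma> t) (\<Gamma> t) = 0" for t
    using lift by (simp add: is_lift_def null_vectors_def)
  \<comment> \<open>A vanishing product has to be excluded separately: \<open>inverse 0 = 0\<close>
    would make \<open>nat\<close> read 0 = 1.\<close>
  have h01: "herm (\<Gamma> t) (g1 t) = \<i>" for t
    using nat[of t] by (cases "herm (\<Gamma> t) (g1 t) = 0") (auto simp: field_simps)
  have h10: "herm (g1 t) (\<Gamma> t) = - \<i>" for t
    using h01 herm_commute[of "g1 t" "\<Gamma> t"] by simp
  have h11: "herm (g1 t) (g1 t) = of_real (2 * \<kappa>)" for t
  proof (rule complex_eqI)
    show "Re (herm (g1 t) (g1 t)) = Re (of_real (2 * \<kappa>))"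
      using assms(2)[of t] by (simp add: bending_def g1_def)
    have "Im (herm (g1 t) (g1 t)) = - Im (herm (g1 t) (g1 t))"
      by (subst herm_commute) simp
    then show "Im (herm (g1 t) (g1 t)) = Im (of_real (2 * \<kappa>))" by simp
  qed
  have h02: "herm (\<Gamma> t) (g2 t) = of_real (- 2 * \<kappa>)" for t
    using vector_derivative_const_unique[OF has_vector_derivative_herm[OF d0 d1] h01, of t] h11[of t]
    by (simp add: add_eq_0_iff)
  have h20: "herm (g2 t) (\<Gamma> t) = of_real (- 2 * \<kappa>)" for t
    using h02 herm_commute[of "g2 t" "\<Gamma> t"] by simp
  have h21: "herm (g2 t) (g1 t) = \<i> * of_real b" for t
  proof (rule complex_eqI)
    have "herm (g2 t) (g1 t) + herm (g1 t) (g2 t) = 0"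
      using vector_derivative_const_unique[OF has_vector_derivative_herm[OF d1 d1] h11, of t] by simp
    then have "Re (herm (g2 t) (g1 t)) + Re (herm (g1 t) (g2 t)) = 0"
      by (metis plus_complex.sel(1) zero_complex.sel(1))
    then show "Re (herm (g2 t) (g1 t)) = Re (\<i> * of_real b)"
      by (subst (asm) (2) herm_commute) simp
    show "Im (herm (g2 t) (g1 t)) = Im (\<i> * of_real b)"
      using assms(2)[of t] by (auto simp: twist_def b_def g1_def g2_def)
  qed
  have h12: "herm (g1 t) (g2 t) = - \<i> * of_real b" for t
    using h21 herm_commute[of "g1 t" "g2 t"] by simp
  have h22: "herm (g2 t) (g2 t) = of_real (1 - 4 * \<kappa> * b - 8 * \<kappa>^3)" for t
    using det3_gram[of "\<Gamma> t" "g1 t" "g2 t"]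
    by (simp add: det h00 h01 h10 h02 h20 h11 h12 h21 algebra_simps power3_eq_cube
      add_eq_0_iff eq_neg_iff_add_eq_0)
  have h03: "herm (\<Gamma> t) (g3 t) = \<i> * of_real b" for t
    using vector_derivative_const_unique[OF has_vector_derivative_herm[OF d0 d2] h02, of t] h12[of t]
    by (simp add: add_eq_0_iff)
  have h13: "herm (g1 t) (g3 t) = - of_real (1 - 4 * \<kappa> * b - 8 * \<kappa>^3)" for t
    using vector_derivative_const_unique[OF has_vector_derivative_herm[OF d1 d2] h12, of t] h22[of t]
    by (simp add: add_eq_0_iff2)
  \<comment> \<open>The other two terms in the derivative of the determinant have a repeated column.
    Hence \<open>g3\<close> has no component along \<open>g2\<close>.\<close>
  have det03: "det3 (\<Gamma> t) (g1 t) (g3 t) = 0" for t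
    using vector_derivative_const_unique[OF has_vector_derivative_det3[OF d0 d1 d2] det, of t]
    by (simp add: det3_degenerate)
  have g3: "g3 t = of_real b *s g1 t - (\<i> * of_real (1 - 2 * \<kappa> * b - 8 * \<kappa>^3)) *s \<Gamma> t" for t
  proof -
    obtain p q where g: "g3 t = p *s \<Gamma> t + q *s g1 t"
    proof
      have "g3 t = (-1) *s (det3 (\<Gamma> t) (g1 t) (g2 t) *s g3 t)"
        by (simp add: det)
      also have "\<dots> = (- det3 (g3 t) (g1 t) (g2 t)) *s \<Gamma> t + (- det3 (\<Gamma> t) (g3 t) (g2 t)) *s g1 t"
        unfolding det3_cramer[of "\<Gamma> t" "g1 t" "g2 t" "g3 t"] det03 by (simp add: vec_eq_iff)
      finally show "g3 t = (- det3 (g3 t) (g1 t) (g2 t)) *s \<Gamma> t + (- det3 (\<Gamma> t) (g3 t) (g2 t)) *s g1 t" .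
    qed
    \<comment> \<open>As \<Gamma> is null, its product with \<open>g3\<close> isolates
      \<open>q\<close>; the product with \<open>g1\<close> then gives \<open>p\<close>.\<close>
    have q: "q = of_real b"
      using h03[of t] by (simp add: g herm_linear h00 h01)
    have "p * \<i> = of_real (1 - 2 * \<kappa> * b - 8 * \<kappa>^3)"
      using h13[of t] by (simp add: g q herm_linear h10 h11 algebra_simps)
    moreover have "p = - \<i> * (p * \<i>)"
      by (simp add: complex_eq_iff)
    ultimately have "p = - \<i> * of_real (1 - 2 * \<kappa> * b - 8 * \<kappa>^3)"
      by simp
    then show ?thesis by (simp add: g q vec_eq_iff)
  qed
  have "frame \<kappa> b \<Gamma> g1 g2"
    unfolding frame_def using d0 d1 d2 det h00 h01 h10 h11 h02 h20 h21 h12 h22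
    by (simp add: g3)
  then show ?thesis by (simp add: b_def g1_def g2_def)
qed

section \<open>Characteristic roots\<close>

text \<open>Applying the differential operator \<open>(d/dt - \<i>y)(d/dt - \<i>z)\<close> to \<open>g0\<close>, where \<open>y, z\<close> are
  the two other roots of the characteristic polynomial \<open>X\<^sup>3 + bX - d\<close>, leaves only the component
  along \<open>exp (\<i>xt)\<close>; the coefficients are rewritten with \<open>y + z = -x\<close> and \<open>yz = b + x\<^sup>2\<close>.\<close>
definition eigen_curve ::
  "real \<Rightarrow> (real \<Rightarrow> complex^3) \<Rightarrow> (real \<Rightarrow> complex^3) \<Rightarrow> (real \<Rightarrow> complex^3) \<Rightarrow> complex \<Rightarrow> real \<Rightarrow> complex^3"
  where
  "eigen_curve b g0 g1 g2 x t = g2 t + (\<i> * x) *s g1 t - (of_real b + x\<^sup>2) *s g0 t"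

section \<open>Exponential solutions of the linear equation\<close>

lemma has_vector_derivative_scale_vec:
  fixes f :: "real \<Rightarrow> complex^3"
  assumes "(c has_vector_derivative c') (at t)" "(f has_vector_derivative f') (at t)"
  shows "((\<lambda>t. c t *s f t) has_vector_derivative c' *s f t + c t *s f') (at t)"
proof -
  have "bounded_bilinear ((*s) :: complex \<Rightarrow> complex^3 \<Rightarrow> complex^3)"
  proof
    show "\<exists>K. \<forall>a b. norm (a *s b :: complex^3) \<le> norm a * norm b * K"
    proof (intro exI allI)
      fix a :: complex and v :: "complex^3"
      have "norm (a *s v) = norm a * norm v"
        by (simp add: norm_vec_def norm_mult L2_set_right_distrib)
      then show "norm (a *s v) \<le> norm a * norm v * 1" by simp
    qed
  qed (simp_all add: vec_eq_iff algebra_simps)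
  then have "((\<lambda>t. c t *s f t) has_vector_derivative c t *s f' + c' *s f t) (at t)"
    by (rule bounded_bilinear.has_vector_derivative[OF _ assms])
  then show ?thesis by (simp add: add.commute)
qed

lemma vector_derivative_zero_unique:
  assumes "\<And>t. (f has_vector_derivative 0) (at t)"
  shows "f t = f s"
  using has_vector_derivative_zero_constant[of UNIV f] assms by (metis UNIV_I convex_UNIV)

lemma has_vector_derivative_exp_of_real:
  "((\<lambda>t. exp (c * of_real t)) has_vector_derivative c * exp (c * of_real t)) (at t)"
  for c :: complex
  by (rule has_vector_derivative_real_field derivative_eq_intros refl)+ simp

text \<open>The integrating factor \<open>exp (- c * of_real t)\<close> turns \<open>W\<close> into
  a function with derivative zero.\<close>

lemma vector_exponential_solution:
  fixes W :: "real \<Rightarrow> complex^3"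
  assumes "\<And>t. (W has_vector_derivative c *s W t) (at t)"
  shows "W t = exp (c * of_real t) *s W 0"
proof -
  have "((\<lambda>t. exp (- c * of_real t) *s W t) has_vector_derivative 0) (at t)" for t
    by (rule has_vector_derivative_scale_vec[OF has_vector_derivative_exp_of_real assms,
          THEN has_vector_derivative_eq_rhs])
      (simp add: vec_eq_iff)
  from vector_derivative_zero_unique[of "\<lambda>t. exp (- c * of_real t) *s W t", OF this, of t 0]
  have "exp (- c * of_real t) *s W t = W 0" by simp
  then have "exp (c * of_real t) *s W 0 = (exp (c * of_real t) * exp (- c * of_real t)) *s W t"
    by (metis vector_smult_assoc)
  then show ?thesis by (simp add: exp_minus)
qed

text \<open>With d the right-hand side, this says that exp (i x t) solves g''' = b g' - i d g, the
  equation of a frame.\<close>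

definition frame_root :: "real \<Rightarrow> real \<Rightarrow> complex \<Rightarrow> bool" where
  "frame_root \<kappa> b x \<longleftrightarrow> x^3 + of_real b * x = of_real (1 - 2 * \<kappa> * b - 8 * \<kappa>^3)"

lemma eigen_curve_exp:
  assumes "frame \<kappa> b g0 g1 g2" "frame_root \<kappa> b x"
  shows "eigen_curve b g0 g1 g2 x t = exp (\<i> * x * of_real t) *s eigen_curve b g0 g1 g2 x 0"
proof (rule vector_exponential_solution)
  fix t
  define d where "d = 1 - 2 * \<kappa> * b - 8 * \<kappa>^3"
  have d: "(g0 has_vector_derivative g1 t) (at t)" "(g1 has_vector_derivative g2 t) (at t)"
     "(g2 has_vector_derivative of_real b *s g1 t - (\<i> * of_real d) *s g0 t) (at t)"
    using assms(1) unfolding frame_def d_def by blast+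
  have x: "of_real d = x^3 + of_real b * x"
    using assms(2) by (simp add: frame_root_def d_def)
  note smult = has_vector_derivative_scale_vec[OF has_vector_derivative_const]
  show "(eigen_curve b g0 g1 g2 x has_vector_derivative
      (\<i> * x) *s eigen_curve b g0 g1 g2 x t) (at t)"
    unfolding eigen_curve_def
    by (rule has_vector_derivative_eq_rhs[OF has_vector_derivative_diff[OF
          has_vector_derivative_add[OF d(3) smult[OF d(2)]] smult[OF d(1)]]])
       (simp add: x vec_eq_iff algebra_simps power2_eq_square power3_eq_cube)
qed

text \<open>Its coefficient at \<open>g2\<close> is 1, so it can replace \<open>g2\<close> in the
  determinant, which is -1.\<close>

lemma eigen_curve_nonzero:
  assumes "frame \<kappa> b g0 g1 g2"
  shows "eigen_curve b g0 g1 g2 x t \<noteq> 0"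
proof
  assume *: "eigen_curve b g0 g1 g2 x t = 0"
  have "det3 (g0 t) (g1 t) (g2 t) = det3 (g0 t) (g1 t) (eigen_curve b g0 g1 g2 x t)"
    by (simp add: det3_expand eigen_curve_def algebra_simps)
  also have "\<dots> = 0" by (simp add: * det3_expand)
  finally show False using assms by (auto simp: frame_def)
qed

section \<open>Consequences of projective periodicity\<close>

text \<open>A priori the multiplier depends on t. Invariance of the product of \<open>g0\<close> and
  \<open>g1\<close> gives it modulus one, and invariance of the product of \<open>g1\<close> with
  itself then forces its derivative to vanish.\<close>

lemma frame_periodic_multiplier:
  assumes fr: "frame \<kappa> b g0 g1 g2" and per: "\<And>t. proj (g0 (t + \<omega>)) = proj (g0 t)"
  obtains c where "norm c = 1" "\<And>t. g0 (t + \<omega>) = c *s g0 t"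
    "\<And>t. g1 (t + \<omega>) = c *s g1 t" "\<And>t. g2 (t + \<omega>) = c *s g2 t"
proof -
  have fr0: "(g0 has_vector_derivative g1 t) (at t)" "(g1 has_vector_derivative g2 t) (at t)"
     "herm (g0 t) (g0 t) = 0" "herm (g0 t) (g1 t) = \<i>" "herm (g1 t) (g0 t) = - \<i>"
     "herm (g1 t) (g1 t) = of_real (2 * \<kappa>)" for t
    using fr unfolding frame_def by blast+
  have shift: "((\<lambda>t. f (t + \<omega>)) has_vector_derivative f') (at t)"
    if "(f has_vector_derivative f') (at (t + \<omega>))" for f :: "real \<Rightarrow> complex^3" and f' t
    using vector_diff_chain_at[of "\<lambda>t. t + \<omega>" 1 t f f'] that
    by (simp add: o_def has_vector_derivative_add_const)
  \<comment> \<open>Reading off the multiplier from a Hermitian product makes its differentiability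
    evident.\<close>
  define c where "c t = \<i> * herm (g1 t) (g0 (t + \<omega>))" for t
  have c: "g0 (t + \<omega>) = c t *s g0 t" for t
  proof -
    have "g0 (t + \<omega>) \<in> proj (g0 t)"
      unfolding per[of t, symmetric] by (simp add: proj_def vec.span_base)
    then obtain k where k: "g0 (t + \<omega>) = k *s g0 t"
      by (auto simp: proj_def vec.span_singleton)
    then have "c t = k" by (simp add: c_def herm_linear fr0 complex_eq_iff)
    with k show ?thesis by simp
  qed
  define c' where "c' t = \<i> * (herm (g2 t) (g0 (t + \<omega>)) + herm (g1 t) (g1 (t + \<omega>)))" for t
  have dc: "(c has_vector_derivative c' t) (at t)" for t
    unfolding c_def c'_def
    by (rule has_vector_derivative_mult_right[OF has_vector_derivative_herm[OF fr0(2) shift[OF fr0(1)]]])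
  have g1c: "g1 (t + \<omega>) = c' t *s g0 t + c t *s g1 t" for t
  proof (rule vector_derivative_unique_at[OF shift[OF fr0(1)]])
    show "((\<lambda>t. g0 (t + \<omega>)) has_vector_derivative c' t *s g0 t + c t *s g1 t) (at t)"
      unfolding c by (rule has_vector_derivative_scale_vec[OF dc fr0(1)])
  qed
  have n: "cnj (c t) * c t = 1" for t
    using fr0(4)[of "t + \<omega>"] unfolding c g1c by (simp add: herm_linear fr0 mult.commute)
  have "cnj (c' t) * c t + cnj (c t) * c' t = 0" for t
    using vector_derivative_const_unique[OF has_vector_derivative_mult[OF has_vector_derivative_cnj[OF dc] dc] n, of t]
    by (simp add: add.commute)
  moreover have "\<i> * (cnj (c' t) * c t) - \<i> * (cnj (c t) * c' t) = 0" for t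
  proof -
    have "\<i> * (cnj (c' t) * c t) - \<i> * (cnj (c t) * c' t) + of_real (2 * \<kappa>) * (cnj (c t) * c t)
        = of_real (2 * \<kappa>)"
      using fr0(6)[of "t + \<omega>"] unfolding g1c by (simp add: herm_linear fr0 algebra_simps)
    then show ?thesis by (simp add: n)
  qed
  \<comment> \<open>For u = cnj c' c and v = cnj c c', the first equation comes from |c| = 1, the
    second from the product of \<open>g1\<close> with itself.\<close>
  moreover have "v = 0" if "u + v = 0" "\<i> * u - \<i> * v = 0" for u v :: complex
    using that by (simp add: complex_eq_iff)
  ultimately have cc': "cnj (c t) * c' t = 0" for t by blast
  have c'0: "c' t = 0" for t using cc'[of t] n[of t] by auto
  have ct: "c t = c 0" for t
    using dc by (intro vector_derivative_zero_unique) (simp add: c'0)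
  have g1c': "g1 (t + \<omega>) = c 0 *s g1 t" for t using g1c ct c'0 by simp
  have "g2 (t + \<omega>) = c 0 *s g2 t" for t
  proof (rule vector_derivative_unique_at[OF shift[OF fr0(2)]])
    show "((\<lambda>t. g1 (t + \<omega>)) has_vector_derivative c 0 *s g2 t) (at t)"
      unfolding g1c'
      using has_vector_derivative_scale_vec[OF has_vector_derivative_const fr0(2), of "c 0" t] by simp
  qed
  moreover have "norm (c 0) = 1" using n by (simp only: cnj_mult_self_eq_1_iff)
  ultimately show thesis using that c ct g1c' by metis
qed

text \<open>A period multiplies the nonzero eigencurve both by \<open>c\<close> and by its own
  exponential. Since |c| = 1, this exponential stays on the unit circle and the root is real. The
  last claim says that the root is simple.\<close>

lemma frame_periodic_root:
  assumes fr: "frame \<kappa> b g0 g1 g2" and "\<omega> > 0" and "norm c = 1"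
    and c: "\<And>t. g0 (t + \<omega>) = c *s g0 t" "\<And>t. g1 (t + \<omega>) = c *s g1 t"
      "\<And>t. g2 (t + \<omega>) = c *s g2 t"
    and x: "frame_root \<kappa> b x"
  shows "exp (\<i> * x * of_real \<omega>) = c" "Im x = 0" "3 * x\<^sup>2 + of_real b \<noteq> 0"
proof -
  let ?W = "eigen_curve b g0 g1 g2 x"
  have "?W (0 + \<omega>) = c *s ?W 0"
    unfolding eigen_curve_def c by (simp add: vec_eq_iff algebra_simps)
  then have "exp (\<i> * x * of_real \<omega>) *s ?W 0 = c *s ?W 0"
    using eigen_curve_exp[OF fr x, of \<omega>] by simp
  then show e: "exp (\<i> * x * of_real \<omega>) = c"
    using eigen_curve_nonzero[OF fr, of x 0] by (auto simp: vec_eq_iff)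
  then have "norm (exp (\<i> * x * of_real \<omega>)) = 1" using assms by simp
  then show "Im x = 0" using \<open>\<omega> > 0\<close> by (simp add: norm_exp_eq_Re)
  show "3 * x\<^sup>2 + of_real b \<noteq> 0"
  proof
    assume *: "3 * x\<^sup>2 + of_real b = 0"
    \<comment> \<open>A double root \<open>x\<close> would produce the solution \<open>exp (\<i>xt) (V 0 + t W)\<close>, whose line is not periodic.\<close>
    define V where "V t = g1 t + (2 * \<i> * x) *s g0 t" for t
    define E where "E t = exp (- (\<i> * x) * of_real t)" for t
    have d: "(g0 has_vector_derivative g1 t) (at t)" "(g1 has_vector_derivative g2 t) (at t)" for t
      using fr unfolding frame_def by blast+
    have dV: "(V has_vector_derivative ?W t + (\<i> * x) *s V t) (at t)" for t
    proof -
      have b: "of_real b = - 3 * x\<^sup>2" using * by (simp add: add_eq_0_iff)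
      show ?thesis unfolding V_def
        by (rule has_vector_derivative_eq_rhs[OF has_vector_derivative_add[OF d(2)
              has_vector_derivative_scale_vec[OF has_vector_derivative_const d(1)]]])
          (simp add: vec_eq_iff eigen_curve_def b algebra_simps power2_eq_square)
    qed
    have EW: "E t *s ?W t = ?W 0" for t
      using eigen_curve_exp[OF fr x, of t] by (simp add: E_def exp_minus)
    have "((\<lambda>t. E t *s V t - t *\<^sub>R ?W 0) has_vector_derivative 0) (at t)" for t
    proof -
      have "((\<lambda>t. E t *s V t) has_vector_derivative ?W 0) (at t)"
        unfolding E_def
        by (rule has_vector_derivative_eq_rhs[OF has_vector_derivative_scale_vec[OF
              has_vector_derivative_exp_of_real dV]])
          (simp add: EW[symmetric, of t] E_def vec_eq_iff algebra_simps)
      moreover have "((\<lambda>t. t *\<^sub>R ?W 0) has_vector_derivative ?W 0) (at t)"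
        by (rule derivative_eq_intros refl | simp)+
      ultimately show ?thesis using has_vector_derivative_diff by fastforce
    qed
    from vector_derivative_zero_unique[of "\<lambda>t. E t *s V t - t *\<^sub>R ?W 0", OF this, of \<omega> 0]
    have "E \<omega> *s V (0 + \<omega>) - \<omega> *\<^sub>R ?W 0 = V 0" by (simp add: E_def)
    moreover have "V (0 + \<omega>) = c *s V 0"
      unfolding V_def c by (simp add: vec_eq_iff algebra_simps)
    moreover have "E \<omega> * c = 1" by (simp add: E_def exp_minus flip: e)
    ultimately have "\<omega> *\<^sub>R ?W 0 = 0" by simp
    then show False using \<open>\<omega> > 0\<close> eigen_curve_nonzero[OF fr, of x 0] by simp
  qed
qed

lemma frame_root_quadratic:
  assumes "frame_root \<kappa> b x" "y\<^sup>2 + x * y + x\<^sup>2 + of_real b = 0"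
  shows "frame_root \<kappa> b y"
proof -
  have "y^3 + of_real b * y - (x^3 + of_real b * x) = (y - x) * (y\<^sup>2 + x * y + x\<^sup>2 + of_real b)"
    by (simp add: algebra_simps power2_eq_square power3_eq_cube)
  then show ?thesis using assms by (simp add: frame_root_def)
qed

lemma frame_root_exists: "\<exists>x. frame_root \<kappa> b x"
proof -
  have "\<exists>z. poly [:- of_real (1 - 2 * \<kappa> * b - 8 * \<kappa>^3), of_real b, 0, 1:] z = (0::complex)"
    by (rule fundamental_theorem_of_algebra_alt) simp
  then show ?thesis
    by (auto simp: frame_root_def algebra_simps power3_eq_cube)
qed

lemma exp_i_eq_imp_commensurable:
  assumes "exp (\<i> * of_real x * of_real \<omega>) = exp (\<i> * of_real y * of_real \<omega>)" "\<omega> > 0"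
  shows "\<exists>n::int. x - y = of_int n * (2 * pi / \<omega>)"
proof -
  obtain n :: int where "\<i> * of_real x * of_real \<omega> =
      \<i> * of_real y * of_real \<omega> + of_real (of_int (2 * n) * pi) * \<i>"
    using assms(1) unfolding exp_eq by blast
  then have "x * \<omega> = y * \<omega> + 2 * of_int n * pi"
    by (simp add: complex_eq_iff)
  then show ?thesis using \<open>\<omega> > 0\<close> by (intro exI[of _ n]) (simp add: field_simps)
qed

text \<open>One complex root exists, the others follow from a quadratic, and periodicity makes all
  of them real and simple. They share the multiplier \<open>c\<close>, so their differences are
  integer multiples of 2 pi / \<omega>; as the roots sum to zero, their ratios are rational.\<close>

lemma periodic_frame_roots:
  assumes fr: "frame \<kappa> b g0 g1 g2" and \<omega>: "\<omega> > 0" and per: "\<And>t. proj (g0 (t + \<omega>)) = proj (g0 t)"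
  obtains x y z :: real where "x < y" "y < z" "x + y + z = 0" "x * y + y * z + z * x = b"
    "x * y * z = 1 - 2 * \<kappa> * b - 8 * \<kappa>^3" "z / x \<in> \<rat>"
proof -
  note result = that
  obtain c where c: "norm c = 1" "\<And>t. g0 (t + \<omega>) = c *s g0 t"
    "\<And>t. g1 (t + \<omega>) = c *s g1 t" "\<And>t. g2 (t + \<omega>) = c *s g2 t"
    using frame_periodic_multiplier[OF fr per] by blast
  note root = frame_periodic_root[OF fr \<omega> c]
  obtain X where X: "frame_root \<kappa> b X" using frame_root_exists by blast
  \<comment> \<open>Quadratic formula for Y^2 + X Y + X^2 + b, the quotient of the cubic by its
    linear factor at \<open>X\<close>.\<close>
  define Y where "Y = (- X + csqrt (- 3 * X\<^sup>2 - 4 * of_real b)) / 2"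
  define Z where "Z = - X - Y"
  have quad: "Y\<^sup>2 + X * Y + X\<^sup>2 + of_real b = 0"
  proof -
    have "2 * Y + X = csqrt (- 3 * X\<^sup>2 - 4 * of_real b)" by (simp add: Y_def field_simps)
    then have "(2 * Y + X)\<^sup>2 = - 3 * X\<^sup>2 - 4 * of_real b" by (simp only: power2_csqrt)
    then have "4 * (Y\<^sup>2 + X * Y + X\<^sup>2 + of_real b) = 0"
      by (simp add: algebra_simps power2_eq_square)
    then show ?thesis by (metis mult_eq_0_iff zero_neq_numeral)
  qed
  have "Z\<^sup>2 + X * Z + X\<^sup>2 + of_real b = Y\<^sup>2 + X * Y + X\<^sup>2 + of_real b"
    by (simp add: Z_def algebra_simps power2_eq_square)
  then have Y: "frame_root \<kappa> b Y" and Z: "frame_root \<kappa> b Z"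
    using frame_root_quadratic[OF X] quad by auto
  obtain x y z where xyz: "X = of_real x" "Y = of_real y" "Z = of_real z"
    using root(2)[OF X] root(2)[OF Y] root(2)[OF Z] by (metis complex_is_Real_iff Reals_cases)
  have z: "z = - x - y" using Z_def by (simp add: xyz flip: of_real_minus of_real_diff)
  have quad': "b = - (y\<^sup>2 + x * y + x\<^sup>2)"
  proof -
    have "of_real (y\<^sup>2 + x * y + x\<^sup>2 + b) = (0::complex)" using quad by (simp add: xyz)
    then show ?thesis unfolding of_real_eq_0_iff by simp
  qed
  have d: "x^3 + b * x = 1 - 2 * \<kappa> * b - 8 * \<kappa>^3"
  proof -
    have "of_real (x^3 + b * x) = (of_real (1 - 2 * \<kappa> * b - 8 * \<kappa>^3) :: complex)"
      using X by (simp add: xyz frame_root_def)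
    then show ?thesis unfolding of_real_eq_iff .
  qed
  have simple: "3 * w\<^sup>2 + b \<noteq> 0" if "frame_root \<kappa> b (of_real w)" for w
  proof
    assume "3 * w\<^sup>2 + b = 0"
    then have "of_real (3 * w\<^sup>2 + b) = (0::complex)" by (simp only: of_real_0)
    then show False using root(3)[OF that] by simp
  qed
  have sx: "3 * x\<^sup>2 + b \<noteq> 0" and sy: "3 * y\<^sup>2 + b \<noteq> 0"
    using simple[of x] simple[of y] X Y by (auto simp: xyz)
  \<comment> \<open>A coincidence of two roots makes the derivative of the cubic vanish
    there.\<close>
  have "x = y \<Longrightarrow> 3 * x\<^sup>2 + b = 0" "y = z \<Longrightarrow> x = - 2 * y" "x = - 2 * y \<Longrightarrow> 3 * y\<^sup>2 + b = 0"
    "x = z \<Longrightarrow> y = - 2 * x" "y = - 2 * x \<Longrightarrow> 3 * x\<^sup>2 + b = 0"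
    by (simp_all add: quad' z power2_eq_square)
  then have distinct: "x \<noteq> y" "y \<noteq> z" "x \<noteq> z" using sx sy by blast+
  have e: "x + y + z = 0" "x * y + y * z + z * x = b" "x * y * z = 1 - 2 * \<kappa> * b - 8 * \<kappa>^3"
    unfolding d[symmetric] by (simp_all add: z quad' algebra_simps power2_eq_square power3_eq_cube)
  have sorted: thesis
    if "u < v" "v < w" and roots: "frame_root \<kappa> b (of_real u)" "frame_root \<kappa> b (of_real v)"
      "frame_root \<kappa> b (of_real w)" and s: "u + v + w = 0" "u * v + v * w + w * u = b"
      "u * v * w = 1 - 2 * \<kappa> * b - 8 * \<kappa>^3" for u v w
  proof (rule result)
    obtain m where m: "u - v = of_int m * (2 * pi / \<omega>)"
      using exp_i_eq_imp_commensurable[of u \<omega> v] root(1) roots \<omega> by metis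
    obtain n where n: "u - w = of_int n * (2 * pi / \<omega>)"
      using exp_i_eq_imp_commensurable[of u \<omega> w] root(1) roots \<omega> by metis
    \<comment> \<open>The zero sum expresses single roots through differences.\<close>
    have "3 * u = (u - v) + (u - w)" "3 * w = (u - v) - 2 * (u - w)"
      using s(1) by algebra+
    then have "3 * u = (of_int m + of_int n) * (2 * pi / \<omega>)"
      and "3 * w = (of_int m - 2 * of_int n) * (2 * pi / \<omega>)"
      by (simp_all only: m n distrib_right left_diff_distrib mult.assoc)
    then have "(3 * w) / (3 * u) = (of_int m - 2 * of_int n) / (of_int m + of_int n)"
      using \<omega> by simp
    then have "w / u = (of_int m - 2 * of_int n) / (of_int m + of_int n)" by simp
    then show "w / u \<in> \<rat>" by simp
  qed fact+
  note XYZ = X[unfolded xyz] Y[unfolded xyz] Z[unfolded xyz]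
  consider "x < y" "y < z" | "x < z" "z < y" | "y < x" "x < z" | "y < z" "z < x"
    | "z < x" "x < y" | "z < y" "y < x"
    using distinct by linarith
  then show thesis
    by cases (rule sorted, assumption, assumption, rule XYZ, rule XYZ, rule XYZ; use e in \<open>simp add: ac_simps\<close>)+
qed

section \<open>Signs, weights and the parameters of the model\<close>

text \<open>The characteristic polynomial takes the value -1 at -2\<kappa>, which gives the product.
  So none or two of the factors are negative, and the first case would imply |\<tau>| \<le>
  9\<kappa>^2 with \<kappa> \<ge> 0, against the second class.\<close>

lemma second_class_root_signs:
  fixes x y z \<kappa> \<tau> :: real
  assumes "x < y" "y < z" and s: "x + y + z = 0" "x * y + y * z + z * x = \<tau> - 3 * \<kappa>\<^sup>2"
    "x * y * z = 1 - 2 * \<kappa> * (\<tau> - 3 * \<kappa>\<^sup>2) - 8 * \<kappa>^3" and "second_class \<kappa> \<tau>"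
  shows "(x + 2 * \<kappa>) * (y + 2 * \<kappa>) * (z + 2 * \<kappa>) = 1" "y + 2 * \<kappa> < 0"
proof -
  have "(x + 2 * \<kappa>) * (y + 2 * \<kappa>) * (z + 2 * \<kappa>) =
      x * y * z + 2 * \<kappa> * (x * y + y * z + z * x) + 4 * \<kappa>\<^sup>2 * (x + y + z) + 8 * \<kappa>^3"
    by (simp add: algebra_simps power2_eq_square power3_eq_cube)
  then show prod: "(x + 2 * \<kappa>) * (y + 2 * \<kappa>) * (z + 2 * \<kappa>) = 1"
    by (simp add: s)
  show "y + 2 * \<kappa> < 0"
  proof (rule ccontr)
    assume "\<not> y + 2 * \<kappa> < 0"
    then have yz: "y + 2 * \<kappa> > 0" "z + 2 * \<kappa> > 0"
      using prod \<open>y < z\<close> by (cases "y + 2 * \<kappa> = 0"; simp)+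
    then have "0 < (y + 2 * \<kappa>) * (z + 2 * \<kappa>)" by simp
    moreover have "0 < (x + 2 * \<kappa>) * ((y + 2 * \<kappa>) * (z + 2 * \<kappa>))"
      using prod by (simp add: mult.assoc)
    ultimately have x: "x + 2 * \<kappa> > 0" by (rule zero_less_mult_pos2[rotated])
    \<comment> \<open>The second symmetric function of the shifted roots equals \<tau> +
      9\<kappa>^2.\<close>
    have "0 < (x + 2 * \<kappa>) * (y + 2 * \<kappa>) + (y + 2 * \<kappa>) * (z + 2 * \<kappa>) + (z + 2 * \<kappa>) * (x + 2 * \<kappa>)"
      using mult_pos_pos[OF x yz(1)] mult_pos_pos[OF yz] mult_pos_pos[OF yz(2) x] by linarith
    also have "\<dots> = (x * y + y * z + z * x) + 4 * \<kappa> * (x + y + z) + 12 * \<kappa>\<^sup>2"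
      by (simp add: algebra_simps power2_eq_square)
    finally have "- \<tau> < 9 * \<kappa>\<^sup>2" by (simp add: s)
    moreover have "\<tau> \<le> 9 * \<kappa>\<^sup>2"
    proof -
      have "2 * (x * y + y * z + z * x) = (x + y + z)\<^sup>2 - (x\<^sup>2 + y\<^sup>2 + z\<^sup>2)"
        by (simp add: algebra_simps power2_eq_square)
      also have "\<dots> \<le> 0"
        unfolding s(1) using add_nonneg_nonneg[OF sum_power2_ge_zero[of x y] zero_le_power2[of z]]
        by (simp only: power_zero_numeral diff_0 neg_le_0_iff_le)
      finally have "\<tau> \<le> 3 * \<kappa>\<^sup>2" by (simp add: s)
      then show ?thesis using zero_le_power2[of \<kappa>] by linarith
    qed
    ultimately have "\<bar>\<tau>\<bar> \<le> (3 * \<kappa>)\<^sup>2" by (simp add: power2_eq_square)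
    \<comment> \<open>The shifted roots sum to 6\<kappa>. The sign matters because the class
      condition compares 3\<kappa> itself, not its modulus.\<close>
    moreover have "0 \<le> 3 * \<kappa>" using x yz s(1) by linarith
    ultimately have "sqrt \<bar>\<tau>\<bar> \<le> 3 * \<kappa>" by (rule real_le_lsqrt[rotated])
    with \<open>second_class \<kappa> \<tau>\<close> show False by (simp add: second_class_def)
  qed
qed

text \<open>The sums are second divided differences of X + k and X (X + k), that is, their leading
  coefficients in degree two. For k = 2\<kappa> the weights are the Hermitian squares of the
  components of the lift: the first sum expresses nullness, the second naturality.\<close>

lemma lagrange_weights:
  fixes x y z k :: "'a :: field"
  assumes "x \<noteq> y" "y \<noteq> z" "x \<noteq> z" "x + y + z = 0"
  defines "n1 \<equiv> (x + k) / ((x - y) * (x - z))"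
    and "n2 \<equiv> (y + k) / ((y - x) * (y - z))"
    and "n3 \<equiv> (z + k) / ((z - x) * (z - y))"
  shows "n1 + n2 + n3 = 0" "x * n1 + y * n2 + z * n3 = 1"
    "n1 * n2 * n3 * ((x - y) * (y - z) * (z - x))\<^sup>2 = - ((x + k) * (y + k) * (z + k))"
proof -
  have nz: "x - y \<noteq> 0" "y - z \<noteq> 0" "x - z \<noteq> 0" "y - x \<noteq> 0" "z - y \<noteq> 0" "z - x \<noteq> 0"
    using assms(1-3) by auto
  define D where "D = (x - y) * (y - z) * (x - z)"
  have D: "D \<noteq> 0" using nz by (simp add: D_def)
  have n: "n1 = (x + k) * (y - z) / D" "n2 = - ((y + k) * (x - z)) / D" "n3 = (z + k) * (x - y) / D"
    unfolding n1_def n2_def n3_def D_def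
    by (simp_all only: frac_eq_eq mult_eq_0_iff nz simp_thms) algebra+
  have "n1 + n2 + n3 = ((x + k) * (y - z) - (y + k) * (x - z) + (z + k) * (x - y)) / D"
    by (simp add: n add_divide_distrib diff_divide_distrib)
  also have "(x + k) * (y - z) - (y + k) * (x - z) + (z + k) * (x - y) = 0"
    by (simp add: algebra_simps)
  finally show "n1 + n2 + n3 = 0" by simp
  have "x * n1 + y * n2 + z * n3 =
      (x * (x + k) * (y - z) - y * (y + k) * (x - z) + z * (z + k) * (x - y)) / D"
    by (simp add: n add_divide_distrib diff_divide_distrib mult.assoc)
  also have "x * (x + k) * (y - z) - y * (y + k) * (x - z) + z * (z + k) * (x - y) = D"
    by (simp add: algebra_simps D_def)
  finally show "x * n1 + y * n2 + z * n3 = 1" using D by simp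
  have "((x - y) * (y - z) * (z - x))\<^sup>2 = D\<^sup>2"
    by (simp add: D_def power2_eq_square algebra_simps)
  moreover have "n1 * n2 * n3 = - ((x + k) * (y + k) * (z + k) * D) / (D * D * D)"
    unfolding n times_divide_times_eq by (rule arg_cong[where f = "\<lambda>u. u / (D * D * D)"]) (simp add: D_def mult_ac)
  ultimately show "n1 * n2 * n3 * ((x - y) * (y - z) * (z - x))\<^sup>2 = - ((x + k) * (y + k) * (z + k))"
    using D by (simp add: power2_eq_square)
qed

text \<open>Up to \<open>N\<close>, the right-hand sides are the signed squared moduli of the
  coordinates of S(\<rho>) in the columns of U (see \<open>S_coords\<close>). Thus \<rho> is read
  off from the ratio of the weights.\<close>

lemma quadric_point_parameter:
  fixes n1 n2 n3 :: real
  assumes "n2 > 0" "n3 > 0" "n1 + n2 + n3 = 0"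
  obtains \<rho> N where "0 < \<rho>" "\<rho> < sqrt 2" "0 < N" "n1 = - (N * (1 + \<rho>\<^sup>2 / 2)\<^sup>2 / 2)"
    "n2 = N * \<rho>\<^sup>2" "n3 = N * (1 - \<rho>\<^sup>2 / 2)\<^sup>2 / 2"
proof -
  \<comment> \<open>\<open>p\<close> is to become \<open>(1 - \<rho>\<^sup>2/2) / (1 + \<rho>\<^sup>2/2)\<close>.\<close>
  define p where "p = sqrt (n3 / (n2 + n3))"
  have p: "0 < p" "p < 1" "p\<^sup>2 = n3 / (n2 + n3)"
    using assms by (simp_all add: p_def)
  then have n3: "n3 = p\<^sup>2 * (n2 + n3)" using assms by simp
  define R where "R = 2 * (1 - p) / (1 + p)"
  define \<rho> where "\<rho> = sqrt R"
  define N where "N = (n2 + n3) * (1 + p)\<^sup>2 / 2"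
  have R: "0 < R" "R < 2" using p by (simp_all add: R_def field_simps)
  have \<rho>2: "\<rho>\<^sup>2 = R" using R by (simp add: \<rho>_def)
  have R1: "1 + R / 2 = 2 / (1 + p)" "1 - R / 2 = 2 * p / (1 + p)"
    using p by (simp_all add: R_def field_simps)
  show thesis
  proof
    show "0 < \<rho>" "\<rho> < sqrt 2" "0 < N"
      using R p assms by (simp_all add: \<rho>_def N_def)
    have "n2 + n3 = N * (1 + \<rho>\<^sup>2 / 2)\<^sup>2 / 2"
      unfolding \<rho>2 R1 using p by (simp add: N_def power_divide)
    then show "n1 = - (N * (1 + \<rho>\<^sup>2 / 2)\<^sup>2 / 2)" using assms by linarith
    have "N * (1 - \<rho>\<^sup>2 / 2)\<^sup>2 / 2 = (n2 + n3) * p\<^sup>2"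
      unfolding \<rho>2 R1 using p by (simp add: N_def power_divide power_mult_distrib)
    then show "n3 = N * (1 - \<rho>\<^sup>2 / 2)\<^sup>2 / 2" using n3 by (simp add: mult.commute)
    have "N * \<rho>\<^sup>2 = (n2 + n3) * ((1 + p) * (1 - p))"
      unfolding \<rho>2 R_def N_def using p(1) by (simp add: field_simps power2_eq_square)
    also have "\<dots> = n2 + n3 - p\<^sup>2 * (n2 + n3)"
      by (simp add: algebra_simps power2_eq_square)
    also have "\<dots> = n2" using n3 by linarith
    finally show "n2 = N * \<rho>\<^sup>2" by simp
  qed
qed

text \<open>The two normalisations become N x B = 8 and (N x^2)^3 Q^2 = 64. Eliminating
  \<open>N\<close> expresses x through r and \<rho>, which is the formula for
  \<open>\<mu>\<^sub>2\<close>. The model eigenvalues are the negatives of the roots, so their order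
  is reversed.\<close>

lemma e23_eq:
  fixes x y z N \<rho> :: real
  assumes "x < y" "y < z" and s: "x + y + z = 0" and \<rho>: "0 < \<rho>" "\<rho> < sqrt 2" and "0 < N"
  defines "n1 \<equiv> - (N * (1 + \<rho>\<^sup>2 / 2)\<^sup>2 / 2)" and "n2 \<equiv> N * \<rho>\<^sup>2"
    and "n3 \<equiv> N * (1 - \<rho>\<^sup>2 / 2)\<^sup>2 / 2"
  assumes w: "x * n1 + y * n2 + z * n3 = 1" "n1 * n2 * n3 * ((x - y) * (y - z) * (z - x))\<^sup>2 = - 1"
  shows "z / x \<in> {-2<..<-1/2}" "e23 (z / x) \<rho> = - x" "e22 (z / x) \<rho> = - y" "e21 (z / x) \<rho> = - z"
proof -
  define r where "r = z / x"
  have x: "x < 0" using assms by linarith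
  have z: "z = r * x" using x by (simp add: r_def)
  have "y = - x - z" using s by linarith
  then have y: "y = - (1 + r) * x" by (simp add: z algebra_simps)
  have "z < - 2 * x" "- x / 2 < z" using assms by linarith+
  then have r: "-2 < r" "r < -1/2" using x by (simp_all add: r_def field_simps)
  then show "z / x \<in> {-2<..<-1/2}" by (simp add: r_def)
  define B where "B = -4 + 4*r - 12*\<rho>^2*(1 + r) + (r - 1)*\<rho>^4"
  define Q where "Q = (2 + 3*r - 3*r^2 - 2*r^3) * (-4*\<rho> + \<rho>^5)"
  \<comment> \<open>This is the value that Q^(2/3) must have by the second normalisation.\<close>
  define P where "P = 4 / (N * x\<^sup>2)"
  have "8 * (x * n1 + y * n2 + z * n3) = N * x * B"
    by (simp add: n1_def n2_def n3_def B_def z y field_simps power2_eq_square power4_eq_xxxx)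
  then have NB: "N * x * B = 8" using w(1) by simp
  have "N * x < 0" using x \<open>0 < N\<close> by (simp add: mult_pos_neg)
  then have B: "B < 0" using NB by (metis not_less_iff_gr_or_eq mult_zero_right mult_neg_pos zero_less_numeral)
  define C E where "C = 2 + 3*r - 3*r^2 - 2*r^3" and "E = -4*\<rho> + \<rho>^5"
  have QCE: "Q = C * E" by (simp only: Q_def C_def E_def)
  have "64 * (n1 * n2 * n3) = - (N^3 * (4 * (1 + \<rho>\<^sup>2 / 2) * (1 - \<rho>\<^sup>2 / 2) * \<rho>)\<^sup>2)"
  proof -
    have "64 * (- (N * p\<^sup>2 / 2) * (N * \<rho>\<^sup>2) * (N * q\<^sup>2 / 2)) = - (N^3 * (4 * p * q * \<rho>)\<^sup>2)" for p q
      by (simp add: power2_eq_square power3_eq_cube)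
    then show ?thesis unfolding n1_def n2_def n3_def .
  qed
  also have "4 * (1 + \<rho>\<^sup>2 / 2) * (1 - \<rho>\<^sup>2 / 2) * \<rho> = - E"
    by (simp add: E_def algebra_simps eval_nat_numeral)
  finally have n: "64 * (n1 * n2 * n3) = - (N^3 * E\<^sup>2)" by simp
  \<comment> \<open>\<open>C\<close> is the Vandermonde product of the roots after scaling by
    x.\<close>
  have "(x - y) * (y - z) * (z - x) = x^3 * C"
    by (simp add: C_def z y algebra_simps eval_nat_numeral)
  then have "64 * (n1 * n2 * n3 * ((x - y) * (y - z) * (z - x))\<^sup>2) = - ((N * x\<^sup>2)^3 * Q\<^sup>2)"
    using n unfolding mult.assoc[of 64, symmetric]
    by (simp add: QCE power_mult_distrib flip: power_mult)
  then have NQ: "(N * x\<^sup>2)^3 * Q\<^sup>2 = 64" using w(2) by simp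
  \<comment> \<open>Both factors of \<open>Q\<close> are negative on the parameter range. Positivity
    lets \<open>powr\<close> invert the cube.\<close>
  have Q: "0 < Q"
  proof -
    have "\<rho>\<^sup>2 < (sqrt 2)\<^sup>2" using \<rho> by (intro power_strict_mono) simp_all
    then have "\<rho>\<^sup>2 < 2" by simp
    then have "(\<rho>\<^sup>2)\<^sup>2 < 2\<^sup>2" by (intro power_strict_mono) simp_all
    then have "\<rho>^4 < 4" by simp
    then have "\<rho> * (\<rho>^4 - 4) < 0" using \<rho> by (simp add: mult_pos_neg)
    moreover have "(2 + r) * (1 - r) * (1 + 2 * r) < 0" using r by (simp add: mult_pos_neg)
    ultimately have "0 < ((2 + r) * (1 - r) * (1 + 2 * r)) * (\<rho> * (\<rho>^4 - 4))"
      by (rule mult_neg_neg[rotated])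
    also have "\<dots> = Q" by (simp add: Q_def algebra_simps eval_nat_numeral)
    finally show ?thesis .
  qed
  have P: "0 < P" using x \<open>0 < N\<close> by (simp add: P_def)
  have "Q\<^sup>2 = P^3"
    using NQ x \<open>0 < N\<close> by (simp add: P_def field_simps)
  then have "(Q powr 2) powr (1/3) = (P powr 3) powr (1/3)"
    using P Q by (simp add: powr_numeral)
  then have Q23: "Q powr (2/3) = P" using P by (simp only: powr_powr) simp
  have \<mu>: "\<mu>\<^sub>2 r \<rho> = B / (B - 2 * P)"
    unfolding \<mu>\<^sub>2_def B_def[symmetric] Q_def[symmetric] Q23 ..
  have "1 - \<mu>\<^sub>2 r \<rho> = - 2 * P / (B - 2 * P)" unfolding \<mu> using B P by (simp add: field_simps)
  then have "\<mu>\<^sub>2 r \<rho> / (1 - \<mu>\<^sub>2 r \<rho>) = - B / (2 * P)" unfolding \<mu> using B P by simp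
  also have "\<dots> = - x"
    using NB x \<open>0 < N\<close> by (simp add: P_def field_simps power2_eq_square)
  finally have e: "\<mu>\<^sub>2 r \<rho> / (1 - \<mu>\<^sub>2 r \<rho>) = - x" .
  show "e23 (z / x) \<rho> = - x" unfolding e23_def r_def[symmetric] e ..
  show "e22 (z / x) \<rho> = - y" unfolding e22_def r_def[symmetric] e by (simp add: y)
  show "e21 (z / x) \<rho> = - z" unfolding e21_def r_def[symmetric] e by (simp add: z)
qed

section \<open>Congruences\<close>

lemma conj_transpose_gram_entry:
  "(conj_transpose A ** herm_matrix ** B) $ i $ j = herm (column i A) (column j B)"
proof -
  have "(conj_transpose A ** herm_matrix ** B) $ i $ j = (conj_transpose A ** (herm_matrix ** B)) $ i $ j"
    by (simp add: matrix_mul_assoc)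
  also have "\<dots> = herm (column i A) (column j B)"
    by (simp add: herm_def conj_vec_def conj_transpose_def column_def matrix_matrix_mult_def
      matrix_vector_mult_def)
  finally show ?thesis .
qed

lemma conj_transpose_mult: "conj_transpose (A ** B) = conj_transpose B ** conj_transpose A"
  by (simp add: vec_eq_iff conj_transpose_def matrix_matrix_mult_def mult.commute)

lemma det_conj_transpose: "det (conj_transpose A) = cnj (det A)"
  by (simp add: det_3 conj_transpose_def mult_ac)

lemma conj_transpose_mat_1: "conj_transpose (mat 1) = mat 1"
  by (simp add: vec_eq_iff conj_transpose_def mat_def)

lemma det_herm_matrix: "det herm_matrix = -1"
  by (simp add: det_3 herm_matrix_def vector_3)

lemma matrix_inv_inverse:
  assumes "invertible A"
  shows "A ** matrix_inv A = mat 1" "matrix_inv A ** A = mat 1"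
  using someI_ex[OF assms[unfolded invertible_def]] by (simp_all add: matrix_inv_def)

text \<open>\<open>W ** matrix_inv V\<close> preserves the form, so its determinant has modulus one.
  Multiplying by a cube root of the inverse determinant reaches determinant 1 and, as this scalar is
  unimodular, keeps the form. The scalar is invisible projectively.\<close>

lemma SU21_transport:
  fixes V W :: "complex^3^3"
  assumes "conj_transpose V ** herm_matrix ** V = conj_transpose W ** herm_matrix ** W"
    and "invertible V"
  obtains A \<delta> where "A \<in> SU21" "\<delta> \<noteq> 0" "\<And>v. A *v (V *v v) = \<delta> *s (W *v v)"
proof -
  define X where "X = matrix_inv V"
  have X: "V ** X = mat 1" "X ** V = mat 1"
    using matrix_inv_inverse[OF \<open>invertible V\<close>] by (simp_all add: X_def)
  define B where "B = W ** X"
  have "conj_transpose B ** herm_matrix ** B =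
      conj_transpose X ** (conj_transpose W ** herm_matrix ** W) ** X"
    by (simp add: B_def conj_transpose_mult matrix_mul_assoc)
  also have "\<dots> = conj_transpose (V ** X) ** herm_matrix ** (V ** X)"
    by (simp add: assms(1)[symmetric] conj_transpose_mult matrix_mul_assoc)
  finally have B: "conj_transpose B ** herm_matrix ** B = herm_matrix"
    by (simp add: X conj_transpose_mat_1)
  then have "det (conj_transpose B ** herm_matrix ** B) = det herm_matrix" by (simp only:)
  then have "cnj (det B) * det B = 1"
    by (simp add: det_mul det_conj_transpose det_herm_matrix)
  then have nd: "norm (det B) = 1" and d0: "det B \<noteq> 0"
    by (auto simp: cnj_mult_self_eq_1_iff)
  define \<delta> where "\<delta> = exp (- Ln (det B) / 3)"
  have "\<delta>^3 = exp (- Ln (det B))" by (simp add: \<delta>_def flip: exp_of_nat_mult)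
  then have \<delta>3: "\<delta>^3 * det B = 1" using d0 by (simp add: exp_minus)
  have "norm (\<delta>^3 * det B) = 1" by (simp only: \<delta>3 norm_one)
  then have "norm \<delta> ^ 3 = 1 ^ 3" by (simp add: norm_mult norm_power nd)
  then have "norm \<delta> = 1" by (rule power_eq_imp_eq_base) simp_all
  then have \<delta>: "cnj \<delta> * \<delta> = 1" by (simp add: cnj_mult_self_eq_1_iff)
  define A where "A = (\<chi> i j. \<delta> * B $ i $ j)"
  show thesis
  proof
    have "det A = \<delta>^3 * det B" by (simp add: A_def det_3 algebra_simps power3_eq_cube)
    moreover have col: "column j A = \<delta> *s column j B" for j
      by (simp add: A_def column_def vec_eq_iff)
    have "herm (column i A) (column j A) = (cnj \<delta> * \<delta>) * herm (column i B) (column j B)" for i j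
      unfolding col herm_linear by simp
    then have "conj_transpose A ** herm_matrix ** A = conj_transpose B ** herm_matrix ** B"
      by (simp add: vec_eq_iff conj_transpose_gram_entry \<delta>)
    ultimately show "A \<in> SU21" by (simp add: SU21_def B \<delta>3)
    show "\<delta> \<noteq> 0" by (simp add: \<delta>_def)
    fix v
    have "A *v u = \<delta> *s (B *v u)" for u
      by (simp add: A_def matrix_vector_mult_def vec_eq_iff sum_distrib_left mult.assoc)
    then have "A *v (V *v v) = \<delta> *s (B *v (V *v v))" .
    also have "B *v (V *v v) = (W ** (X ** V)) *v v"
      by (simp add: B_def matrix_vector_mul_assoc matrix_mul_assoc)
    finally show "A *v (V *v v) = \<delta> *s (W *v v)" by (simp add: X)
  qed
qed

section \<open>Projective action, diagonal exponentials and the model configurations\<close>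

lemma act_proj: "act A (proj z) = proj (A *v z)"
  by (auto simp: act_def proj_def vec.span_singleton vector_scalar_commute image_iff)

lemma proj_scale: "c \<noteq> 0 \<Longrightarrow> proj (c *s z) = proj z"
  unfolding proj_def by (rule vec.span_image_scale[of "{z}" "\<lambda>_. c", simplified])

lemma matrix_exp_diagonal:
  fixes d :: "complex^3"
  shows "matrix_exp (\<chi> i j. if i = j then d $ i else 0) = (\<chi> i j. if i = j then exp (d $ i) else 0)"
proof -
  let ?A = "\<chi> i j. if i = j then d $ i else 0"
  have pow: "(((**) ?A) ^^ n) (mat 1) = (\<chi> i j. if i = j then d $ i ^ n else 0)" for n
    by (induction n)
      (simp_all add: mat_def vec_eq_iff matrix_matrix_mult_def if_distrib[of "\<lambda>x. x * _"] cong: if_cong)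
  \<comment> \<open>Convergence is checked entrywise, where the diagonal series are scalar
    exponential series.\<close>
  have "(\<lambda>n. (\<Sum>k<n. (((**) ?A) ^^ k) (mat 1) /\<^sub>R fact k)) \<longlonglongrightarrow> (\<chi> i j. if i = j then exp (d $ i) else 0)"
  proof (intro vec_tendstoI)
    fix i j
    show "(\<lambda>n. (\<Sum>k<n. (((**) ?A) ^^ k) (mat 1) /\<^sub>R fact k) $ i $ j)
        \<longlonglongrightarrow> (\<chi> i j. if i = j then exp (d $ i) else 0) $ i $ j"
      using exp_converges[of "d $ j"] by (simp add: pow sum_component sums_def)
  qed
  then show ?thesis
    unfolding matrix_exp_def by (intro sums_unique[symmetric]) (simp add: sums_def)
qed

text \<open>The coordinates of the representative of S(\<rho>) in the basis of columns of U.\<close>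

definition S_coords :: "real \<Rightarrow> complex^3" where
  "S_coords \<rho> = vector [of_real ((1 + \<rho>\<^sup>2 / 2) / sqrt 2), of_real \<rho>,
     - \<i> * of_real ((1 - \<rho>\<^sup>2 / 2) / sqrt 2)]"

lemma sqrt2_mult_self: "complex_of_real (sqrt 2) * complex_of_real (sqrt 2) = 2"
  by (simp flip: of_real_mult)

lemma U_matrix_S_coords: "U_matrix *v S_coords \<rho> = vector [1, of_real \<rho>, \<i> * of_real (\<rho>^2) / 2]"
proof -
  show ?thesis using sqrt2_mult_self
    by (simp add: vec_eq_iff forall_3 U_matrix_def S_coords_def matrix_vector_mult_def sum_3
        vector_3 field_simps)
qed

text \<open>The columns form a pseudo-orthonormal basis whose first vector is the timelike one. It
  carries the eigenvalue \<open>e23\<close>, hence corresponds to the least root.\<close>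

lemma herm_column_U_matrix:
  "herm (column i U_matrix) (column j U_matrix) = (if i = j then if i = 1 then -1 else 1 else 0)"
proof -
  have "\<forall>i j. herm (column i U_matrix) (column j U_matrix) = (if i = j then if i = 1 then -1 else 1 else 0)"
    using sqrt2_mult_self by (simp add: forall_3 U_matrix_def herm_expand column_def vector_3)
  then show ?thesis by blast
qed

lemma invertible_U_matrix: "invertible U_matrix"
proof -
  have "det U_matrix = 1"
    using sqrt2_mult_self by (simp add: det_3 U_matrix_def vector_3 field_simps)
  then show ?thesis by (simp add: invertible_det_nz)
qed

text \<open>Conjugation by U makes the flow diagonal, so it only multiplies the coordinates of
  S(\<rho>) by phases.\<close>

lemma sym_config2_eq:
  "sym_config2 r \<rho> s = proj (U_matrix *v (\<chi> i. exp (- \<i> * of_real (s * vector [e23 r \<rho>, e22 r \<rho>, e21 r \<rho>] $ i))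
     * S_coords \<rho> $ i))"
proof -
  define d :: "complex^3" where "d = (\<chi> i. - \<i> * of_real (s * (vector [e23 r \<rho>, e22 r \<rho>, e21 r \<rho>] :: real^3) $ i))"
  have "s *\<^sub>R D\<^sub>2 r \<rho> = (\<chi> i j. if i = j then d $ i else 0)"
    by (simp add: vec_eq_iff forall_3 D\<^sub>2_def d_def vector_3) (simp add: scaleR_conv_of_real)
  then have M: "matrix_exp (s *\<^sub>R D\<^sub>2 r \<rho>) = (\<chi> i j. if i = j then exp (d $ i) else 0)"
    by (simp only: matrix_exp_diagonal)
  have "matrix_inv U_matrix *v (U_matrix *v S_coords \<rho>) = S_coords \<rho>"
    by (simp add: matrix_vector_mul_assoc matrix_inv_inverse(2)[OF invertible_U_matrix])
  then have "sym_config2 r \<rho> s = proj (U_matrix *v (matrix_exp (s *\<^sub>R D\<^sub>2 r \<rho>) *v S_coords \<rho>))"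
    by (simp add: sym_config2_def S_point_def act_proj U_matrix_S_coords flip: matrix_vector_mul_assoc)
  also have "matrix_exp (s *\<^sub>R D\<^sub>2 r \<rho>) *v S_coords \<rho> = (\<chi> i. exp (d $ i) * S_coords \<rho> $ i)"
    by (simp add: M matrix_vector_mult_def vec_eq_iff if_distrib[of "\<lambda>x. x * _"] cong: if_cong)
  finally show ?thesis by (simp add: d_def)
qed

section \<open>Orthogonal eigencomponents of the lift\<close>

lemma herm_eigen_curve:
  assumes "frame \<kappa> b g0 g1 g2"
  shows "herm (eigen_curve b g0 g1 g2 (of_real x) t) (eigen_curve b g0 g1 g2 (of_real y) t) =
    of_real (1 - 4 * \<kappa> * b - 8 * \<kappa>^3 - b * (x + y) + 2 * \<kappa> * (2 * b + x\<^sup>2 + y\<^sup>2 + x * y)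
      + x * (b + y\<^sup>2) + y * (b + x\<^sup>2))"
proof -
  have fr: "herm (g0 t) (g0 t) = 0" "herm (g0 t) (g1 t) = \<i>" "herm (g1 t) (g0 t) = - \<i>"
     "herm (g0 t) (g2 t) = of_real (- 2 * \<kappa>)" "herm (g2 t) (g0 t) = of_real (- 2 * \<kappa>)"
     "herm (g1 t) (g1 t) = of_real (2 * \<kappa>)"
     "herm (g1 t) (g2 t) = - \<i> * of_real b" "herm (g2 t) (g1 t) = \<i> * of_real b"
     "herm (g2 t) (g2 t) = of_real (1 - 4 * \<kappa> * b - 8 * \<kappa>^3)"
    using assms unfolding frame_def by blast+
  have i: "\<i> * (\<i> * u) = - u" for u by (simp flip: mult.assoc)
  show ?thesis
    unfolding eigen_curve_def herm_linear fr by (simp add: algebra_simps i)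
qed

lemma herm_eigen_curve_roots:
  fixes x y z :: real
  assumes fr: "frame \<kappa> b g0 g1 g2" and s: "x + y + z = 0" "x * y + y * z + z * x = b"
    "x * y * z = 1 - 2 * \<kappa> * b - 8 * \<kappa>^3"
  shows "herm (eigen_curve b g0 g1 g2 (of_real x) t) (eigen_curve b g0 g1 g2 (of_real y) t) = 0"
    "herm (eigen_curve b g0 g1 g2 (of_real x) t) (eigen_curve b g0 g1 g2 (of_real x) t) =
      of_real ((x + 2 * \<kappa>) * ((x - y) * (x - z)))"
proof -
  have z: "z = - x - y" using s(1) by linarith
  have d: "1 - 4 * \<kappa> * b - 8 * \<kappa>^3 = x * y * z - 2 * \<kappa> * b" using s(3) by linarith
  have "1 - 4 * \<kappa> * b - 8 * \<kappa>^3 - b * (x + y) + 2 * \<kappa> * (2 * b + x\<^sup>2 + y\<^sup>2 + x * y)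
      + x * (b + y\<^sup>2) + y * (b + x\<^sup>2) = 0"
    unfolding d unfolding s(2)[symmetric] z by (simp add: algebra_simps power2_eq_square)
  then show "herm (eigen_curve b g0 g1 g2 (of_real x) t) (eigen_curve b g0 g1 g2 (of_real y) t) = 0"
    by (simp only: herm_eigen_curve[OF fr] of_real_0)
  have "1 - 4 * \<kappa> * b - 8 * \<kappa>^3 - b * (x + x) + 2 * \<kappa> * (2 * b + x\<^sup>2 + x\<^sup>2 + x * x)
      + x * (b + x\<^sup>2) + x * (b + x\<^sup>2) = (x + 2 * \<kappa>) * ((x - y) * (x - z))"
    unfolding d unfolding s(2)[symmetric] z by (simp add: algebra_simps power2_eq_square)
  then show "herm (eigen_curve b g0 g1 g2 (of_real x) t) (eigen_curve b g0 g1 g2 (of_real x) t) =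
      of_real ((x + 2 * \<kappa>) * ((x - y) * (x - z)))"
    by (simp only: herm_eigen_curve[OF fr])
qed

text \<open>Lagrange interpolation for differential operators: each eigencurve applies (d/dt - i
  y)(d/dt - i z), and the weighted sum of the three operators is the identity. The minus signs come
  from (i x - i y)(i x - i z) = -(x - y)(x - z).\<close>

lemma eigen_curve_decomposition:
  fixes x y z :: complex
  assumes "x \<noteq> y" "y \<noteq> z" "x \<noteq> z" and s: "x + y + z = 0" "x * y + y * z + z * x = of_real b"
  shows "g0 t = (- 1 / ((x - y) * (x - z))) *s eigen_curve b g0 g1 g2 x t
    + (- 1 / ((y - x) * (y - z))) *s eigen_curve b g0 g1 g2 y t
    + (- 1 / ((z - x) * (z - y))) *s eigen_curve b g0 g1 g2 z t"
proof -
  have nz: "x - y \<noteq> 0" "y - z \<noteq> 0" "x - z \<noteq> 0" "y - x \<noteq> 0" "z - y \<noteq> 0" "z - x \<noteq> 0"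
    using assms(1-3) by auto
  define D where "D = (x - y) * (y - z) * (x - z)"
  have D: "D \<noteq> 0" using nz by (simp add: D_def)
  have a: "- 1 / ((x - y) * (x - z)) = (z - y) / D" "- 1 / ((y - x) * (y - z)) = (x - z) / D"
    "- 1 / ((z - x) * (z - y)) = (y - x) / D"
    unfolding D_def by (simp_all only: frac_eq_eq mult_eq_0_iff nz simp_thms) algebra+
  have b: "of_real b + x\<^sup>2 = y * z" "of_real b + y\<^sup>2 = x * z" "of_real b + z\<^sup>2 = x * y"
    unfolding s(2)[symmetric] using s(1) by algebra+
  have "((z - y) / D) * (p + \<i> * x * q - y * z * r) + ((x - z) / D) * (p + \<i> * y * q - x * z * r)
      + ((y - x) / D) * (p + \<i> * z * q - x * y * r) = r" for p q r
  proof -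
    have "((z - y) / D) * (p + \<i> * x * q - y * z * r) + ((x - z) / D) * (p + \<i> * y * q - x * z * r)
        + ((y - x) / D) * (p + \<i> * z * q - x * y * r)
      = ((z - y) * (p + \<i> * x * q - y * z * r) + (x - z) * (p + \<i> * y * q - x * z * r)
        + (y - x) * (p + \<i> * z * q - x * y * r)) / D"
      by (simp only: add_divide_distrib times_divide_eq_left)
    also have "(z - y) * (p + \<i> * x * q - y * z * r) + (x - z) * (p + \<i> * y * q - x * z * r)
        + (y - x) * (p + \<i> * z * q - x * y * r) = D * r"
      by (simp add: D_def algebra_simps)
    finally show ?thesis using D by simp
  qed
  then show ?thesis
    unfolding a eigen_curve_def b
    by (simp only: vec_eq_iff vector_add_component vector_minus_component vector_smult_component simp_thms)
qed

lemma frame_root_of_sums: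
  fixes x y z :: real
  assumes "x + y + z = 0" "x * y + y * z + z * x = b" "x * y * z = 1 - 2 * \<kappa> * b - 8 * \<kappa>^3"
  shows "frame_root \<kappa> b (of_real x)"
proof -
  have z: "z = - x - y" using assms(1) by linarith
  have "x^3 + b * x = x * y * z"
    unfolding assms(2)[symmetric] z
    by (simp add: algebra_simps power2_eq_square power3_eq_cube)
  with assms(3) have "x^3 + b * x = 1 - 2 * \<kappa> * b - 8 * \<kappa>^3" by simp
  then have "of_real (x^3 + b * x) = (of_real (1 - 2 * \<kappa> * b - 8 * \<kappa>^3) :: complex)"
    by (simp only:)
  then show ?thesis by (simp add: frame_root_def)
qed

text \<open>The component of the lift at time 0 is \<open>(- 1 / of_real m) *s w\<close>, with
  Hermitian square \<open>y / m\<close>. Taking \<omega> to be the model coordinate, phase included,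
  makes it sqrt N times that coordinate on the unit vector \<open>p\<close>.\<close>

lemma normalised_eigenvector:
  fixes w :: "complex^3" and y m n N \<epsilon> :: real and \<omega> :: complex
  assumes "herm w w = of_real (y * m)" "m \<noteq> 0" "y / m = \<epsilon> * N * (norm \<omega>)\<^sup>2" "N > 0" "\<omega> \<noteq> 0"
  defines "p \<equiv> (- 1 / (of_real m * of_real (sqrt N) * \<omega>)) *s w"
  shows "herm p p = of_real \<epsilon>" "(- 1 / of_real m) *s w = (of_real (sqrt N) * \<omega>) *s p"
proof -
  let ?c = "- 1 / (of_real m * of_real (sqrt N) * \<omega>)"
  have "herm p p = cnj ?c * ?c * of_real (y * m)"
    unfolding p_def herm_linear assms(1) by (simp only: mult_ac)
  also have "cnj ?c * ?c = of_real ((norm ?c)\<^sup>2)"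
    by (simp add: complex_norm_square mult.commute del: of_real_power)
  also have "(norm ?c)\<^sup>2 = 1 / (m\<^sup>2 * N * (norm \<omega>)\<^sup>2)"
    using \<open>N > 0\<close> by (simp add: norm_divide norm_mult power_divide power_mult_distrib)
  also have "of_real (1 / (m\<^sup>2 * N * (norm \<omega>)\<^sup>2)) * of_real (y * m) =
      of_real ((y / m) / (N * (norm \<omega>)\<^sup>2))"
    unfolding of_real_mult[symmetric] of_real_eq_iff using \<open>m \<noteq> 0\<close>
    by (simp add: power2_eq_square)
  also have "(y / m) / (N * (norm \<omega>)\<^sup>2) = \<epsilon>"
    unfolding assms(3) using assms(4,5) by simp
  finally show "herm p p = of_real \<epsilon>" .
  show "(- 1 / of_real m) *s w = (of_real (sqrt N) * \<omega>) *s p"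
    using assms(2,4,5) by (simp add: p_def vector_smult_assoc)
qed

lemma frame_congruent_sym_config2:
  assumes fr: "frame \<kappa> b g0 g1 g2"
    and "x < y" "y < z" and s: "x + y + z = 0" "x * y + y * z + z * x = b"
    "x * y * z = 1 - 2 * \<kappa> * b - 8 * \<kappa>^3"
    and pr: "(x + 2 * \<kappa>) * (y + 2 * \<kappa>) * (z + 2 * \<kappa>) = 1" and "y + 2 * \<kappa> < 0"
  obtains A \<rho> where "A \<in> SU21" "z / x \<in> {-2<..<-1/2}" "\<rho> \<in> {0<..<sqrt 2}"
    "\<And>t. act A (proj (g0 t)) = sym_config2 (z / x) \<rho> t"
proof -
  define m1 m2 m3 where "m1 = (x - y) * (x - z)" and "m2 = (y - x) * (y - z)"
    and "m3 = (z - x) * (z - y)"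
  \<comment> \<open>These are the derivatives of the cubic at its ordered roots, so the signs
    alternate.\<close>
  have m: "m1 > 0" "m2 < 0" "m3 > 0"
    using \<open>x < y\<close> \<open>y < z\<close> by (simp_all add: m1_def m2_def m3_def mult_neg_neg mult_pos_neg)
  define n1 n2 n3 where "n1 = (x + 2 * \<kappa>) / m1" and "n2 = (y + 2 * \<kappa>) / m2"
    and "n3 = (z + 2 * \<kappa>) / m3"
  have ne: "x \<noteq> y" "y \<noteq> z" "x \<noteq> z" using \<open>x < y\<close> \<open>y < z\<close> by auto
  note weights = lagrange_weights[OF ne s(1), of "2 * \<kappa>",
      folded m1_def m2_def m3_def, folded n1_def n2_def n3_def, unfolded pr]
  have "0 < (x + 2 * \<kappa>) * (y + 2 * \<kappa>)"
    using \<open>x < y\<close> \<open>y + 2 * \<kappa> < 0\<close> by (intro mult_neg_neg) linarith+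
  moreover have "0 < ((x + 2 * \<kappa>) * (y + 2 * \<kappa>)) * (z + 2 * \<kappa>)" using pr by simp
  ultimately have "0 < z + 2 * \<kappa>" by (rule zero_less_mult_pos[rotated])
  then have "n2 > 0" "n3 > 0"
    using m \<open>y + 2 * \<kappa> < 0\<close> by (simp_all add: n2_def n3_def divide_neg_neg)
  then obtain \<rho> N where \<rho>: "0 < \<rho>" "\<rho> < sqrt 2" and "0 < N"
    and n: "n1 = - (N * (1 + \<rho>\<^sup>2 / 2)\<^sup>2 / 2)" "n2 = N * \<rho>\<^sup>2" "n3 = N * (1 - \<rho>\<^sup>2 / 2)\<^sup>2 / 2"
    using quadric_point_parameter[OF _ _ weights(1)] by blast
  note e = e23_eq[OF \<open>x < y\<close> \<open>y < z\<close> s(1) \<rho> \<open>0 < N\<close>, folded n, OF weights(2,3)]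
  let ?W = "\<lambda>w. eigen_curve b g0 g1 g2 (of_real w)"
  have "\<rho>\<^sup>2 < (sqrt 2)\<^sup>2" using \<rho> by (intro power_strict_mono) simp_all
  then have \<rho>2: "1 - \<rho>\<^sup>2 / 2 > 0" by simp
  have "1 + \<rho>\<^sup>2 / 2 > 0" by (simp add: add_pos_nonneg)
  then have \<omega>: "S_coords \<rho> $ 1 \<noteq> 0" "S_coords \<rho> $ 2 \<noteq> 0" "S_coords \<rho> $ 3 \<noteq> 0"
    using \<rho> \<rho>2 by (simp_all add: S_coords_def vector_3 flip: of_real_power of_real_divide of_real_add)
  have norms: "(norm (S_coords \<rho> $ 1))\<^sup>2 = (1 + \<rho>\<^sup>2 / 2)\<^sup>2 / 2" "(norm (S_coords \<rho> $ 2))\<^sup>2 = \<rho>\<^sup>2"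
    "(norm (S_coords \<rho> $ 3))\<^sup>2 = (1 - \<rho>\<^sup>2 / 2)\<^sup>2 / 2"
    unfolding S_coords_def vector_3 norm_mult norm_minus_cancel norm_ii norm_of_real mult_1
    by (simp_all add: power_divide)
  \<comment> \<open>Cyclic permutations, so that facts about the first root apply to each of
    them.\<close>
  have s': "y + z + x = 0" "y * z + z * x + x * y = b" "y * z * x = 1 - 2 * \<kappa> * b - 8 * \<kappa>^3"
    "z + x + y = 0" "z * x + x * y + y * z = b" "z * x * y = 1 - 2 * \<kappa> * b - 8 * \<kappa>^3"
    using s by (simp_all add: ac_simps)
  note orth = herm_eigen_curve_roots[OF fr s] herm_eigen_curve_roots[OF fr s'(1-3)]
    herm_eigen_curve_roots[OF fr s'(4-6)]
  have W: "herm (?W x 0) (?W x 0) = of_real ((x + 2 * \<kappa>) * m1)"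
    "herm (?W y 0) (?W y 0) = of_real ((y + 2 * \<kappa>) * m2)"
    "herm (?W z 0) (?W z 0) = of_real ((z + 2 * \<kappa>) * m3)"
    using orth by (simp_all add: m1_def m2_def m3_def mult.commute)
  define p where "p m j w = (- 1 / (of_real m * of_real (sqrt N) * S_coords \<rho> $ j)) *s w"
    for m j and w :: "complex^3"
  have ratio: "(x + 2 * \<kappa>) / m1 = -1 * N * (norm (S_coords \<rho> $ 1))\<^sup>2"
    "(y + 2 * \<kappa>) / m2 = 1 * N * (norm (S_coords \<rho> $ 2))\<^sup>2"
    "(z + 2 * \<kappa>) / m3 = 1 * N * (norm (S_coords \<rho> $ 3))\<^sup>2"
    unfolding norms using n by (simp_all add: n1_def n2_def n3_def)
  note nv = normalised_eigenvector[OF W(1) _ ratio(1) \<open>0 < N\<close> \<omega>(1), folded p_def]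
    normalised_eigenvector[OF W(2) _ ratio(2) \<open>0 < N\<close> \<omega>(2), folded p_def]
    normalised_eigenvector[OF W(3) _ ratio(3) \<open>0 < N\<close> \<omega>(3), folded p_def]
  define p1 p2 p3 where "p1 = p m1 1 (?W x 0)" and "p2 = p m2 2 (?W y 0)" and "p3 = p m3 3 (?W z 0)"
  define V :: "complex^3^3" where "V = transpose (vector [p1, p2, p3])"
  have col: "column 1 V = p1" "column 2 V = p2" "column 3 V = p3"
    by (simp_all add: V_def column_transpose row_def vector_3)
  have "herm p1 p1 = -1" "herm p2 p2 = 1" "herm p3 p3 = 1"
    using nv m by (simp_all add: p1_def p2_def p3_def)
  moreover have "herm p1 p2 = 0" "herm p2 p3 = 0" "herm p3 p1 = 0"
    unfolding p1_def p2_def p3_def p_def herm_linear orth by simp_all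
  moreover have "herm p2 p1 = 0" "herm p3 p2 = 0" "herm p1 p3 = 0"
    using calculation herm_commute[of p2 p1] herm_commute[of p3 p2] herm_commute[of p1 p3] by simp_all
  ultimately have "\<forall>i j. herm (column i V) (column j V) = (if i = j then if i = 1 then -1 else 1 else 0)"
    by (simp add: forall_3 col)
  \<comment> \<open>The normalised eigenvectors and the columns of U have the same Gram matrix; its
    determinant also shows that \<open>V\<close> is invertible.\<close>
  then have VU: "conj_transpose V ** herm_matrix ** V =
      conj_transpose U_matrix ** herm_matrix ** U_matrix"
    by (simp add: vec_eq_iff conj_transpose_gram_entry herm_column_U_matrix)
  then have "det (conj_transpose V ** herm_matrix ** V) =
      det (conj_transpose U_matrix ** herm_matrix ** U_matrix)" by (simp only:)
  then have "det V \<noteq> 0"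
    using invertible_U_matrix by (auto simp: det_mul det_conj_transpose det_herm_matrix invertible_det_nz)
  then have "invertible V" by (simp add: invertible_det_nz)
  then obtain A \<delta> where A: "A \<in> SU21" "\<delta> \<noteq> 0" "\<And>v. A *v (V *v v) = \<delta> *s (U_matrix *v v)"
    using SU21_transport[OF VU] by blast
  \<comment> \<open>The coordinates of the model curve in the columns of U; those of
    \<open>g0\<close> in \<open>V\<close> differ only by the factor sqrt N.\<close>
  define q where "q t = (\<chi> i. exp (- \<i> * of_real (t * vector [- x, - y, - z] $ i)) * S_coords \<rho> $ i)" for t
  have g0: "g0 t = of_real (sqrt N) *s (V *v q t)" for t
  proof -
    have ne': "complex_of_real x \<noteq> of_real y" "complex_of_real y \<noteq> of_real z" "complex_of_real x \<noteq> of_real z"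
      using ne by simp_all
    have sc: "complex_of_real x + of_real y + of_real z = 0"
      "complex_of_real x * of_real y + of_real y * of_real z + of_real z * of_real x = of_real b"
      using s(1,2) by (simp_all flip: of_real_add of_real_mult)
    have ex: "?W w t = exp (\<i> * of_real w * of_real t) *s ?W w 0" if "frame_root \<kappa> b (of_real w)" for w
      by (rule eigen_curve_exp[OF fr that])
    have "g0 t = (- 1 / of_real m1) *s ?W x t + (- 1 / of_real m2) *s ?W y t + (- 1 / of_real m3) *s ?W z t"
      using eigen_curve_decomposition[OF ne' sc, of g0 t g1 g2] by (simp add: m1_def m2_def m3_def)
    also have "\<dots> = exp (\<i> * of_real x * of_real t) *s ((- 1 / of_real m1) *s ?W x 0)
        + exp (\<i> * of_real y * of_real t) *s ((- 1 / of_real m2) *s ?W y 0)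
        + exp (\<i> * of_real z * of_real t) *s ((- 1 / of_real m3) *s ?W z 0)"
      by (simp add: ex[OF frame_root_of_sums[OF s]] ex[OF frame_root_of_sums[OF s'(1-3)]]
          ex[OF frame_root_of_sums[OF s'(4-6)]] vector_smult_assoc mult.commute)
    also have "\<dots> = exp (\<i> * of_real x * of_real t) *s ((of_real (sqrt N) * S_coords \<rho> $ 1) *s p1)
        + exp (\<i> * of_real y * of_real t) *s ((of_real (sqrt N) * S_coords \<rho> $ 2) *s p2)
        + exp (\<i> * of_real z * of_real t) *s ((of_real (sqrt N) * S_coords \<rho> $ 3) *s p3)"
      using nv m by (simp add: p1_def p2_def p3_def)
    also have "\<dots> = of_real (sqrt N) *s (V *v q t)"
      by (simp add: vec_eq_iff V_def q_def transpose_def matrix_vector_mult_def sum_3 vector_3 algebra_simps)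
    finally show ?thesis .
  qed
  show thesis
  proof
    show "A \<in> SU21" "z / x \<in> {-2<..<-1/2}" "\<rho> \<in> {0<..<sqrt 2}" using A e \<rho> by simp_all
    fix t
    have "A *v g0 t = (of_real (sqrt N) * \<delta>) *s (U_matrix *v q t)"
      by (simp add: g0 A(3) vector_scalar_commute vector_smult_assoc)
    then have "act A (proj (g0 t)) = proj (U_matrix *v q t)"
      using \<open>0 < N\<close> A(2) by (simp add: act_proj proj_scale)
    also have "\<dots> = sym_config2 (z / x) \<rho> t"
      by (simp add: sym_config2_eq e q_def)
    finally show "act A (proj (g0 t)) = sym_config2 (z / x) \<rho> t" .
  qed
qed

theorem proposition4p18:
  fixes \<gamma> :: "real \<Rightarrow> cline" and \<kappa> \<tau> :: real
  assumes "isoparametric_string \<gamma> \<kappa> \<tau>"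
    and "second_class \<kappa> \<tau>"
  shows "\<exists>A\<in>SU21. \<exists>r\<in>{-2<..<-1/2} \<inter> \<rat>. \<exists>\<rho>\<in>{0<..<sqrt 2}. \<exists>c.
           \<forall>s. act A (\<gamma> s) = sym_config2 r \<rho> (s + c)"
proof -
  obtain \<Gamma> \<omega> where \<Gamma>: "natural_lift \<Gamma> \<gamma>" "\<And>t. bending \<Gamma> t = \<kappa> \<and> twist \<Gamma> t = \<tau>"
    and \<omega>: "\<omega> > 0" "\<And>t. \<gamma> (t + \<omega>) = \<gamma> t"
    using assms(1) unfolding isoparametric_string_def isoparametric_def by blast
  have \<gamma>: "\<gamma> t = proj (\<Gamma> t)" for t
    using \<Gamma>(1) by (simp add: natural_lift_def wilczynski_lift_def is_lift_def)
  note frame = natural_lift_frame[OF \<Gamma>]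
  obtain x y z where xyz: "x < y" "y < z" "x + y + z = 0" "x * y + y * z + z * x = \<tau> - 3 * \<kappa>\<^sup>2"
    "x * y * z = 1 - 2 * \<kappa> * (\<tau> - 3 * \<kappa>\<^sup>2) - 8 * \<kappa>^3" "z / x \<in> \<rat>"
    using periodic_frame_roots[OF frame \<omega>(1) \<omega>(2)[unfolded \<gamma>]] by blast
  obtain A \<rho> where "A \<in> SU21" "z / x \<in> {-2<..<-1/2}" "\<rho> \<in> {0<..<sqrt 2}"
    "\<And>t. act A (proj (\<Gamma> t)) = sym_config2 (z / x) \<rho> t"
    using frame_congruent_sym_config2[OF frame xyz(1-5) second_class_root_signs[OF xyz(1-5) assms(2)]]
    by blast
  \<comment> \<open>The shift is 0, since the phases at time 0 were absorbed into the normalised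
    eigenvectors.\<close>
  then show ?thesis
    using xyz(6) by (intro bexI[of _ A] bexI[of _ "z / x"] bexI[of _ \<rho>] exI[of _ 0]) (simp_all add: \<gamma>)
qed

end
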